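(* Let $M(\varphi,\xi,\eta,g)$ be an almost coKähler manifold and let $V=\alpha\xi$ for some smooth function $\alpha$ on $M$. If $V$ is mixed Killing with mixed Killing factor $f$, then: 1. for every vector field $X$ on $M$, $\alpha^2(\nabla_\xi h)X=((\varphi X)\alpha)\,(\operatorname{grad}\alpha-(\xi\alpha)\xi)+\alpha^2\varphi h^2X+\alpha(f+\alpha-\xi\alpha)hX$; 2. $(\xi\alpha)^2=|\operatorname{grad}\alpha|^2+\alpha^2\operatorname{tr}(h^2)$.
   Context: A vector field $V$ on a (semi-)Riemannian manifold $(M,g)$ is a mixed Killing vector field if there exists a non-zero smooth function $f$ on $M$ (the mixed Killing factor) such that $L_VL_Vg=fL_Vg$, where $L_V$ is the Lie derivative along $V$. An almost contact metric manifold $M^{2n+1}(\varphi,\xi,\eta,g)$ ($n\ge 1$) is a Riemannian manifold $(M,g)$ of dimension $2n+1$ with a vector field $\xi$ (the Reeb vector field), a global 1-form $\eta$ and a $(1,1)$ tensor field $\varphi$ such that for all vector fields $X,Y$: $\varphi^2Y=-Y+\eta(Y)\xi$, $\eta(\xi)=1$, $g(\varphi X,\varphi Y)=g(X,Y)-\eta(X)\eta(Y)$. Its fundamental 2-form is $\Phi(X,Y)=g(X,\varphi Y)$. It is almost coKähler if $d\eta=0$ and $d\Phi=0$. On it one defines $h=\frac12L_\xi\varphi$. $\nabla$ is the Levi-Civita connection, and $X\alpha$ denotes the derivative of the function $\alpha$ along the vector field $X$. *)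

theory Defs
  imports "HOL-Analysis.Analysis" "HOL-Library.Function_Algebras"
begin

instantiation "fun" :: (type, real_vector) real_vector
begin

definition scaleR_fun :: "real \<Rightarrow> ('a \<Rightarrow> 'b) \<Rightarrow> 'a \<Rightarrow> 'b"
  where "scaleR_fun c f = (\<lambda>x. c *\<^sub>R f x)"

instance
  by standard (simp_all add: scaleR_fun_def fun_eq_iff scaleR_add_left scaleR_add_right)

end

subsection \<open>Smooth manifolds\<close>

text \<open>On an open set, \<open>C^k\<close> means that all iterated directional derivatives up to
  order \<open>k\<close> exist and are continuous.\<close>

primrec Ck_on :: "nat \<Rightarrow> ('a::real_normed_vector \<Rightarrow> 'b::real_normed_vector) \<Rightarrow> 'a set \<Rightarrow> bool" where
  "Ck_on 0 f S \<longleftrightarrow> continuous_on S f"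
| "Ck_on (Suc k) f S \<longleftrightarrow>
     (\<forall>x\<in>S. f differentiable (at x)) \<and> (\<forall>v. Ck_on k (\<lambda>x. frechet_derivative f (at x) v) S)"

definition smooth_on :: "('a::real_normed_vector \<Rightarrow> 'b::real_normed_vector) \<Rightarrow> 'a set \<Rightarrow> bool"
  where "smooth_on f S \<longleftrightarrow> (\<forall>k. Ck_on k f S)"

text \<open>A chart is a pair \<open>(U, x)\<close>; the coordinate map \<open>x\<close> only matters on \<open>U\<close>. The underlying
  set of the manifold is the whole type \<open>'m\<close>. Atlases need not be maximal.\<close>

type_synonym ('m, 'e) atlas = "('m set \<times> ('m \<Rightarrow> 'e)) set"

definition smooth_atlas ::
  "('m::{t2_space,second_countable_topology}, 'e::euclidean_space) atlas \<Rightarrow> bool" where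
  "smooth_atlas A \<longleftrightarrow>
     (\<forall>(U, x)\<in>A. open U \<and> open (x ` U) \<and> homeomorphism U (x ` U) x (inv_into U x)) \<and>
     (\<Union>(U, x)\<in>A. U) = UNIV \<and>
     (\<forall>(U, x)\<in>A. \<forall>(W, y)\<in>A. smooth_on (y \<circ> inv_into U x) (x ` (U \<inter> W)))"

definition smooth_funs :: "('m, 'e::euclidean_space) atlas \<Rightarrow> ('m \<Rightarrow> real) set" where
  "smooth_funs A = {f. \<forall>(U, x)\<in>A. smooth_on (f \<circ> inv_into U x) (x ` U)}"

text \<open>Tangent vectors at \<open>p\<close> are the derivations at \<open>p\<close> of the algebra of smooth functions. They
  are set to \<open>0\<close> on non-smooth functions, so that equality in HOL is equality of tangent vectors.\<close>

type_synonym 'm tvec = "('m \<Rightarrow> real) \<Rightarrow> real"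

definition tangent_space :: "('m, 'e::euclidean_space) atlas \<Rightarrow> 'm \<Rightarrow> 'm tvec set" where
  "tangent_space A p = {v.
     (\<forall>f\<in>smooth_funs A. \<forall>k\<in>smooth_funs A. v (f + k) = v f + v k \<and> v (f * k) = f p * v k + k p * v f) \<and>
     (\<forall>c. \<forall>f\<in>smooth_funs A. v (c *\<^sub>R f) = c * v f) \<and>
     (\<forall>f. f \<notin> smooth_funs A \<longrightarrow> v f = 0)}"

type_synonym 'm vfield = "'m \<Rightarrow> 'm tvec"

definition vderiv :: "'m vfield \<Rightarrow> ('m \<Rightarrow> real) \<Rightarrow> ('m \<Rightarrow> real)"
  where "vderiv X f = (\<lambda>p. X p f)"

definition vector_fields :: "('m, 'e::euclidean_space) atlas \<Rightarrow> 'm vfield set" where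
  "vector_fields A =
     {X. (\<forall>p. X p \<in> tangent_space A p) \<and> (\<forall>f\<in>smooth_funs A. vderiv X f \<in> smooth_funs A)}"

definition fscale :: "('m \<Rightarrow> real) \<Rightarrow> 'm vfield \<Rightarrow> 'm vfield"  (infixr "\<odot>" 75)
  where "f \<odot> X = (\<lambda>p. f p *\<^sub>R X p)"

definition bracket :: "'m vfield \<Rightarrow> 'm vfield \<Rightarrow> 'm vfield"
  where "bracket X Y = (\<lambda>p f. X p (vderiv Y f) - Y p (vderiv X f))"

subsection \<open>Tensor fields\<close>

text \<open>Tensor fields are maps on vector fields that are multilinear over the smooth functions; their
  values outside \<open>vector_fields A\<close> are irrelevant.\<close>

type_synonym 'm form1 = "'m vfield \<Rightarrow> 'm \<Rightarrow> real"
type_synonym 'm form2 = "'m vfield \<Rightarrow> 'm vfield \<Rightarrow> 'm \<Rightarrow> real"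
type_synonym 'm endo = "'m vfield \<Rightarrow> 'm vfield"

definition one_form :: "('m, 'e::euclidean_space) atlas \<Rightarrow> 'm form1 \<Rightarrow> bool" where
  "one_form A \<omega> \<longleftrightarrow>
     (\<forall>X\<in>vector_fields A. \<omega> X \<in> smooth_funs A) \<and>
     (\<forall>X\<in>vector_fields A. \<forall>Y\<in>vector_fields A. \<omega> (X + Y) = \<omega> X + \<omega> Y) \<and>
     (\<forall>f\<in>smooth_funs A. \<forall>X\<in>vector_fields A. \<omega> (f \<odot> X) = f * \<omega> X)"

definition tensor02 :: "('m, 'e::euclidean_space) atlas \<Rightarrow> 'm form2 \<Rightarrow> bool" where
  "tensor02 A T \<longleftrightarrow>
     (\<forall>X\<in>vector_fields A. one_form A (\<lambda>Y. T X Y) \<and> one_form A (\<lambda>Y. T Y X))"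

definition tensor11 :: "('m, 'e::euclidean_space) atlas \<Rightarrow> 'm endo \<Rightarrow> bool" where
  "tensor11 A S \<longleftrightarrow>
     (\<forall>X\<in>vector_fields A. S X \<in> vector_fields A) \<and>
     (\<forall>X\<in>vector_fields A. \<forall>Y\<in>vector_fields A. S (X + Y) = S X + S Y) \<and>
     (\<forall>f\<in>smooth_funs A. \<forall>X\<in>vector_fields A. S (f \<odot> X) = f \<odot> S X)"

definition lie02 :: "'m vfield \<Rightarrow> 'm form2 \<Rightarrow> 'm form2" where
  "lie02 V T = (\<lambda>X Y. vderiv V (T X Y) - T (bracket V X) Y - T X (bracket V Y))"

definition lie11 :: "'m vfield \<Rightarrow> 'm endo \<Rightarrow> 'm endo" where
  "lie11 V S = (\<lambda>X. bracket V (S X) - S (bracket V X))"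

definition ext_d1 :: "'m form1 \<Rightarrow> 'm form2" where
  "ext_d1 \<omega> = (\<lambda>X Y. vderiv X (\<omega> Y) - vderiv Y (\<omega> X) - \<omega> (bracket X Y))"

definition ext_d2 :: "'m form2 \<Rightarrow> 'm vfield \<Rightarrow> 'm vfield \<Rightarrow> 'm vfield \<Rightarrow> 'm \<Rightarrow> real" where
  "ext_d2 \<Omega> = (\<lambda>X Y Z.
     vderiv X (\<Omega> Y Z) + vderiv Y (\<Omega> Z X) + vderiv Z (\<Omega> X Y)
     - \<Omega> (bracket X Y) Z - \<Omega> (bracket Y Z) X - \<Omega> (bracket Z X) Y)"

text \<open>The value \<open>S_p v\<close> of a (1,1) tensor field is \<open>(S X)_p\<close> for any vector field \<open>X\<close> with \<open>X_p = v\<close>;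
  by tensoriality the choice of \<open>X\<close> is irrelevant. Likewise the trace of an endomorphism of a
  finite-dimensional space does not depend on the chosen basis.\<close>

definition tensor11_at :: "('m, 'e::euclidean_space) atlas \<Rightarrow> 'm endo \<Rightarrow> 'm \<Rightarrow> 'm tvec \<Rightarrow> 'm tvec" where
  "tensor11_at A S p v = S (SOME X. X \<in> vector_fields A \<and> X p = v) p"

definition trace_on :: "'v::real_vector set \<Rightarrow> ('v \<Rightarrow> 'v) \<Rightarrow> real" where
  "trace_on W L =
     (let B = (SOME B. B \<subseteq> W \<and> independent B \<and> W \<subseteq> span B)
      in \<Sum>b\<in>B. representation B (L b) b)"

definition trace11 :: "('m, 'e::euclidean_space) atlas \<Rightarrow> 'm endo \<Rightarrow> 'm \<Rightarrow> real" where
  "trace11 A S = (\<lambda>p. trace_on (tangent_space A p) (tensor11_at A S p))"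

subsection \<open>Riemannian metrics\<close>

definition riemannian_metric :: "('m, 'e::euclidean_space) atlas \<Rightarrow> 'm form2 \<Rightarrow> bool" where
  "riemannian_metric A g \<longleftrightarrow>
     tensor02 A g \<and>
     (\<forall>X\<in>vector_fields A. \<forall>Y\<in>vector_fields A. g X Y = g Y X) \<and>
     (\<forall>X\<in>vector_fields A. \<forall>p. X p \<noteq> 0 \<longrightarrow> g X X p > 0)"

definition grad :: "('m, 'e::euclidean_space) atlas \<Rightarrow> 'm form2 \<Rightarrow> ('m \<Rightarrow> real) \<Rightarrow> 'm vfield" where
  "grad A g f = (THE Z. Z \<in> vector_fields A \<and> (\<forall>X\<in>vector_fields A. g Z X = vderiv X f))"

text \<open>\<open>D X Y\<close> is the covariant derivative of \<open>Y\<close> along \<open>X\<close>. The conditions determine \<open>D\<close> on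
  vector fields.\<close>

definition affine_connection ::
  "('m, 'e::euclidean_space) atlas \<Rightarrow> ('m vfield \<Rightarrow> 'm vfield \<Rightarrow> 'm vfield) \<Rightarrow> bool" where
  "affine_connection A D \<longleftrightarrow>
     (\<forall>Y\<in>vector_fields A. tensor11 A (\<lambda>X. D X Y)) \<and>
     (\<forall>X\<in>vector_fields A. \<forall>Y\<in>vector_fields A. \<forall>Z\<in>vector_fields A. D X (Y + Z) = D X Y + D X Z) \<and>
     (\<forall>X\<in>vector_fields A. \<forall>f\<in>smooth_funs A. \<forall>Y\<in>vector_fields A.
        D X (f \<odot> Y) = vderiv X f \<odot> Y + f \<odot> D X Y)"

definition levi_civita ::
  "('m, 'e::euclidean_space) atlas \<Rightarrow> 'm form2 \<Rightarrow> ('m vfield \<Rightarrow> 'm vfield \<Rightarrow> 'm vfield) \<Rightarrow> bool" where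
  "levi_civita A g D \<longleftrightarrow>
     affine_connection A D \<and>
     (\<forall>X\<in>vector_fields A. \<forall>Y\<in>vector_fields A. D X Y - D Y X = bracket X Y) \<and>
     (\<forall>X\<in>vector_fields A. \<forall>Y\<in>vector_fields A. \<forall>Z\<in>vector_fields A.
        vderiv X (g Y Z) = g (D X Y) Z + g Y (D X Z))"

definition cov11 ::
  "('m vfield \<Rightarrow> 'm vfield \<Rightarrow> 'm vfield) \<Rightarrow> 'm vfield \<Rightarrow> 'm endo \<Rightarrow> 'm endo" where
  "cov11 D V S = (\<lambda>X. D V (S X) - S (D V X))"

definition mixed_killing ::
  "('m, 'e::euclidean_space) atlas \<Rightarrow> 'm form2 \<Rightarrow> 'm vfield \<Rightarrow> ('m \<Rightarrow> real) \<Rightarrow> bool" where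
  "mixed_killing A g V f \<longleftrightarrow>
     V \<in> vector_fields A \<and> f \<in> smooth_funs A \<and> f \<noteq> 0 \<and>
     (\<forall>X\<in>vector_fields A. \<forall>Y\<in>vector_fields A.
        lie02 V (lie02 V g) X Y = f * lie02 V g X Y)"

subsection \<open>Almost contact metric and almost coKaehler manifolds\<close>

definition almost_contact_metric ::
  "nat \<Rightarrow> ('m::{t2_space,second_countable_topology}, 'e::euclidean_space) atlas \<Rightarrow>
   'm endo \<Rightarrow> 'm vfield \<Rightarrow> 'm form1 \<Rightarrow> 'm form2 \<Rightarrow> bool" where
  "almost_contact_metric n A \<phi> \<xi> \<eta> g \<longleftrightarrow>
     n \<ge> 1 \<and> DIM('e) = 2 * n + 1 \<and> smooth_atlas A \<and> riemannian_metric A g \<and>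
     \<xi> \<in> vector_fields A \<and> one_form A \<eta> \<and> tensor11 A \<phi> \<and>
     (\<forall>Y\<in>vector_fields A. \<phi> (\<phi> Y) = - Y + \<eta> Y \<odot> \<xi>) \<and>
     \<eta> \<xi> = 1 \<and>
     (\<forall>X\<in>vector_fields A. \<forall>Y\<in>vector_fields A. g (\<phi> X) (\<phi> Y) = g X Y - \<eta> X * \<eta> Y)"

definition fundamental_form :: "'m form2 \<Rightarrow> 'm endo \<Rightarrow> 'm form2"
  where "fundamental_form g \<phi> = (\<lambda>X Y. g X (\<phi> Y))"

definition almost_cokaehler ::
  "nat \<Rightarrow> ('m::{t2_space,second_countable_topology}, 'e::euclidean_space) atlas \<Rightarrow>
   'm endo \<Rightarrow> 'm vfield \<Rightarrow> 'm form1 \<Rightarrow> 'm form2 \<Rightarrow> bool" where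
  "almost_cokaehler n A \<phi> \<xi> \<eta> g \<longleftrightarrow>
     almost_contact_metric n A \<phi> \<xi> \<eta> g \<and>
     (\<forall>X\<in>vector_fields A. \<forall>Y\<in>vector_fields A. ext_d1 \<eta> X Y = 0) \<and>
     (\<forall>X\<in>vector_fields A. \<forall>Y\<in>vector_fields A. \<forall>Z\<in>vector_fields A.
        ext_d2 (fundamental_form g \<phi>) X Y Z = 0)"

definition reeb_h :: "'m endo \<Rightarrow> 'm vfield \<Rightarrow> 'm endo"
  where "reeb_h \<phi> \<xi> = (\<lambda>X. (1/2) *\<^sub>R lie11 \<xi> \<phi> X)"

end

theory Submission
  imports Defs
begin

text \<open>
  Write \<open>b = L\<^sub>\<xi> g\<close>. Closedness of \<open>\<Phi>\<close> and \<open>\<eta>\<close> gives \<open>b(\<phi>X, \<phi>Y) = -b(X, Y)\<close>, and differentiating this along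
  \<open>\<xi>\<close> gives \<open>(L\<^sub>\<xi> b)(X, X) + (L\<^sub>\<xi> b)(\<phi>X, \<phi>X) = 8 |hX|\<^sup>2\<close>. For \<open>V = \<alpha>\<xi>\<close> and \<open>\<eta>(X) = 0\<close> one has
  \<open>(L\<^sub>V g)(X, X) = \<alpha> b(X, X)\<close> and
  \<open>(L\<^sub>V L\<^sub>V g)(X, X) = \<alpha> (\<xi>\<alpha>) b(X, X) + \<alpha>\<^sup>2 (L\<^sub>\<xi> b)(X, X) + 2 (X\<alpha>)\<^sup>2\<close>. Adding the mixed Killing equation
  at \<open>X\<close> and at \<open>\<phi>X\<close>, all terms in \<open>b\<close> cancel and
  \<open>8 \<alpha>\<^sup>2 |hX|\<^sup>2 + 2 (X\<alpha>)\<^sup>2 + 2 ((\<phi>X)\<alpha>)\<^sup>2 = 0\<close> remains. Hence \<open>\<alpha>h = 0\<close> and \<open>grad \<alpha> = (\<xi>\<alpha>)\<xi>\<close>, and every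
  term of the two identities other than \<open>(\<xi>\<alpha>)\<^sup>2 = |grad \<alpha>|\<^sup>2\<close> vanishes.

  The trace is taken over all derivations at a point, so one also needs that each of them is the
  value of a vector field; this follows from Hadamard's lemma in a chart and a smooth cutoff.
\<close>

section \<open>Smooth functions on open sets\<close>

text \<open>Since \<open>S\<close> is open, the derivative at a point of \<open>S\<close> is
  determined by the values on \<open>S\<close>, so agreement passes to all iterated
  derivatives.\<close>

lemma Ck_on_cong:
  assumes "open S" "\<And>x. x \<in> S \<Longrightarrow> f x = g x" "Ck_on k f S"
  shows "Ck_on k g S"
  using assms(2,3)
proof (induction k arbitrary: f g)
  case 0
  then show ?case by (simp cong: continuous_on_cong)
next
  case (Suc k)
  have d: "(g has_derivative frechet_derivative f (at x)) (at x)" if "x \<in> S" for x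
  proof (rule has_derivative_transform_within_open)
    show "(f has_derivative frechet_derivative f (at x)) (at x)"
      using Suc.prems that by (auto simp: frechet_derivative_works)
  qed (use assms(1) that Suc.prems in auto)
  then have eq: "frechet_derivative f (at x) = frechet_derivative g (at x)" if "x \<in> S" for x
    using frechet_derivative_at that by blast
  have "Ck_on k (\<lambda>x. frechet_derivative g (at x) v) S" for v
  proof (rule Suc.IH)
    show "Ck_on k (\<lambda>x. frechet_derivative f (at x) v) S" using Suc.prems(2) by simp
  qed (simp add: eq)
  then show ?case using d by (auto simp: differentiable_def)
qed

lemma Ck_on_subset: "Ck_on k f S \<Longrightarrow> T \<subseteq> S \<Longrightarrow> Ck_on k f T"
  by (induction k arbitrary: f) (auto intro: continuous_on_subset)

text \<open>Lets an explicit derivative stand in for \<open>frechet_derivative\<close>, so the usual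
  differentiation rules can drive the inductions below.\<close>

lemma Ck_on_SucI:
  assumes "open S" "\<And>x. x \<in> S \<Longrightarrow> (f has_derivative f' x) (at x)" "\<And>v. Ck_on k (\<lambda>x. f' x v) S"
  shows "Ck_on (Suc k) f S"
proof -
  have "Ck_on k (\<lambda>x. frechet_derivative f (at x) v) S" for v
  proof (rule Ck_on_cong[OF assms(1) _ assms(3)[of v]])
    show "f' x v = frechet_derivative f (at x) v" if "x \<in> S" for x
      using frechet_derivative_at[OF assms(2)[OF that]] by simp
  qed
  then show ?thesis using assms(2) by (auto simp: differentiable_def)
qed

lemma Ck_on_SucD:
  assumes "Ck_on (Suc k) f S" "x \<in> S"
  shows "(f has_derivative frechet_derivative f (at x)) (at x)"
  using assms by (auto simp: frechet_derivative_works)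

lemma Ck_on_Suc_imp: "Ck_on (Suc k) f S \<Longrightarrow> Ck_on k f S"
proof (induction k arbitrary: f)
  case 0
  then show ?case
    by (auto intro!: continuous_at_imp_continuous_on differentiable_imp_continuous_within)
next
  case (Suc k)
  then show ?case using Ck_on.simps(2) by blast
qed

lemma Ck_on_imp_continuous: "Ck_on k f S \<Longrightarrow> continuous_on S f"
proof (induction k)
  case (Suc k)
  then show ?case using Ck_on_Suc_imp by blast
qed simp

text \<open>Splits a derivative into partial derivatives, to which the closure rules for finite sums
  and products apply.\<close>

lemma linear_real_sum_Basis:
  fixes L :: "'a::euclidean_space \<Rightarrow> real"
  assumes "linear L"
  shows "L v = (\<Sum>b\<in>Basis. (v \<bullet> b) * L b)"
proof -
  have "L v = L (\<Sum>b\<in>Basis. (v \<bullet> b) *\<^sub>R b)" by (simp only: euclidean_representation)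
  also have "\<dots> = (\<Sum>b\<in>Basis. (v \<bullet> b) * L b)"
    by (simp only: linear_sum[OF assms] linear_scale[OF assms] real_scaleR_def)
  finally show ?thesis .
qed

text \<open>Serves for functions that are given by different formulas near different points, such as
  extensions by zero.\<close>

lemma Ck_on_local:
  assumes "\<And>x. x \<in> S \<Longrightarrow> \<exists>T. open T \<and> x \<in> T \<and> Ck_on k f T"
  shows "Ck_on k f S"
  using assms
proof (induction k arbitrary: f)
  case 0
  have "isCont f x" if "x \<in> S" for x
    using 0[OF that] continuous_on_eq_continuous_at by auto
  then show ?case by (simp add: continuous_at_imp_continuous_on)
next
  case (Suc k)
  show ?case
    unfolding Ck_on.simps
  proof (intro conjI ballI allI)
    show "f differentiable at x" if "x \<in> S" for x
      using Suc.prems[OF that] by auto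
    show "Ck_on k (\<lambda>x. frechet_derivative f (at x) v) S" for v
      by (rule Suc.IH) (use Suc.prems in fastforce)
  qed
qed

lemma Ck_on_const: "Ck_on k (\<lambda>x. c) S"
  by (induction k arbitrary: c) auto

lemma Ck_on_bounded_linear:
  assumes "bounded_linear f" shows "Ck_on k f S"
proof (cases k)
  case 0
  then show ?thesis using assms linear_continuous_on by auto
next
  case (Suc j)
  have "(f has_derivative f) (at x)" for x
    using assms bounded_linear_imp_has_derivative by blast
  then have "Ck_on (Suc j) f UNIV"
    by (intro Ck_on_SucI[where f' = "\<lambda>_. f"] Ck_on_const) auto
  then show ?thesis using Suc Ck_on_subset by blast
qed

lemma Ck_on_add:
  assumes "open S" "Ck_on k f S" "Ck_on k g S"
  shows "Ck_on k (\<lambda>x. f x + g x) S"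
  using assms(2,3)
proof (induction k arbitrary: f g)
  case 0
  then show ?case by (auto intro: continuous_intros)
next
  case (Suc k)
  show ?case
    by (rule Ck_on_SucI[OF assms(1) has_derivative_add[OF Ck_on_SucD[OF Suc.prems(1)] Ck_on_SucD[OF Suc.prems(2)]]])
       (use Suc in auto)
qed

lemma Ck_on_sum:
  assumes "open S" "\<And>i. i \<in> I \<Longrightarrow> Ck_on k (f i) S"
  shows "Ck_on k (\<lambda>x. \<Sum>i\<in>I. f i x) S"
  using assms(2)
  by (induction I rule: infinite_finite_induct) (auto simp: Ck_on_const intro!: Ck_on_add assms(1))

lemma Ck_on_mult:
  fixes f g :: "'a::real_normed_vector \<Rightarrow> real"
  assumes "open S" "Ck_on k f S" "Ck_on k g S"
  shows "Ck_on k (\<lambda>x. f x * g x) S"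
  using assms(2,3)
proof (induction k arbitrary: f g)
  case 0
  then show ?case by (auto intro: continuous_intros)
next
  case (Suc k)
  \<comment> \<open>The Leibniz rule leaves one factor undifferentiated in each term, so the
    induction hypothesis needs \<open>f\<close> and \<open>g\<close> themselves at order
    \<open>k\<close>.\<close>
  note Suc.prems(1)[THEN Ck_on_Suc_imp] Suc.prems(2)[THEN Ck_on_Suc_imp]
  then show ?case
    by (intro Ck_on_SucI[OF assms(1) has_derivative_mult[OF Ck_on_SucD[OF Suc.prems(1)] Ck_on_SucD[OF Suc.prems(2)]]]
          Ck_on_add assms(1) Suc.IH) (use Suc.prems in auto)
qed

lemma Ck_on_inner_right:
  assumes "open S" "Ck_on k f S"
  shows "Ck_on k (\<lambda>x. f x \<bullet> b) S"
  using assms(2)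
proof (induction k arbitrary: f)
  case 0
  then show ?case by (auto intro: continuous_intros)
next
  case (Suc k)
  show ?case
    by (rule Ck_on_SucI[OF assms(1) has_derivative_inner_left[OF Ck_on_SucD[OF Suc.prems]]])
       (use Suc in auto)
qed

text \<open>The induction keeps \<open>f\<close> fixed and varies \<open>g\<close>: in the chain
  rule, expanded over the basis, the only compositions with \<open>f\<close> are those of partial
  derivatives of \<open>g\<close>.\<close>

lemma Ck_on_compose:
  fixes f :: "'a::real_normed_vector \<Rightarrow> 'b::euclidean_space" and g :: "'b \<Rightarrow> real"
  assumes "open S" "open T" "f ` S \<subseteq> T" "Ck_on k f S" "Ck_on k g T"
  shows "Ck_on k (\<lambda>x. g (f x)) S"
  using assms(4,5)
proof (induction k arbitrary: g)
  case 0
  then show ?case using assms(3) continuous_on_compose2 by auto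
next
  case (Suc k)
  let ?f' = "\<lambda>x. frechet_derivative f (at x)" and ?g' = "\<lambda>y. frechet_derivative g (at y)"
  have fk: "Ck_on k f S" using Suc.prems(1) by (rule Ck_on_Suc_imp)
  have lin: "?g' (f x) (?f' x v) = (\<Sum>b\<in>Basis. (?f' x v \<bullet> b) * ?g' (f x) b)" if "x \<in> S" for x v
  proof -
    have "linear (?g' (f x))"
      using Ck_on_SucD[OF Suc.prems(2), of "f x"] assms(3) that
      by (auto dest!: has_derivative_linear)
    then show ?thesis by (rule linear_real_sum_Basis)
  qed
  have "((\<lambda>x. g (f x)) has_derivative (\<lambda>v. \<Sum>b\<in>Basis. (?f' x v \<bullet> b) * ?g' (f x) b)) (at x)"
    if "x \<in> S" for x
  proof -
    have "f x \<in> T" using assms(3) that by auto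
    from has_derivative_compose[OF Ck_on_SucD[OF Suc.prems(1) that] Ck_on_SucD[OF Suc.prems(2) this]]
    show ?thesis by (simp add: lin[OF that])
  qed
  moreover have "Ck_on k (\<lambda>x. \<Sum>b\<in>Basis. (?f' x v \<bullet> b) * ?g' (f x) b) S" for v
    by (intro Ck_on_sum Ck_on_mult Ck_on_inner_right assms(1) Suc.IH fk) (use Suc.prems in auto)
  ultimately show ?case by (rule Ck_on_SucI[OF assms(1)])
qed

section \<open>A smooth bump function\<close>

text \<open>For \<open>m = 0\<close> this is the classical function exp(-1/t), extended by zero. The
  powers in the denominator make the family closed under differentiation, up to linear
  combinations.\<close>

definition flat :: "nat \<Rightarrow> real \<Rightarrow> real" where
  "flat m t = (if t > 0 then exp (- 1 / t) / t ^ m else 0)"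

text \<open>From the right, the substitution s = 1/t turns the quotient into s^m / exp s as s tends
  to infinity.\<close>

lemma flat_at_0: "((\<lambda>t. flat m t) \<longlongrightarrow> 0) (at 0)"
proof -
  have "((\<lambda>s::real. s ^ m / exp s) \<longlongrightarrow> 0) at_top"
    by (rule tendsto_power_div_exp_0)
  then have "((\<lambda>t. inverse t ^ m / exp (inverse t)) \<longlongrightarrow> 0) (at_right (0::real))"
    by (rule filterlim_compose) (rule filterlim_inverse_at_top_right)
  then have r: "((\<lambda>t. flat m t) \<longlongrightarrow> 0) (at_right 0)"
    by (rule Lim_transform_eventually)
       (auto simp: eventually_at_filter flat_def field_simps exp_minus power_inverse inverse_eq_divide)
  have "((\<lambda>t. flat m t) \<longlongrightarrow> 0) (at_left 0)"
    by (rule Lim_transform_eventually[OF tendsto_const])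
       (auto simp: eventually_at_filter flat_def)
  with r show ?thesis by (simp add: filterlim_split_at)
qed

lemma flat_has_real_derivative:
  "(flat m has_real_derivative (flat (m + 2) t - m * flat (m + 1) t)) (at t)"
proof -
  consider "t > 0" | "t < 0" | "t = 0" by linarith
  then show ?thesis
  proof cases
    case 1
    have "((\<lambda>t. exp (- 1 / t) / t ^ m) has_real_derivative
            (flat (m + 2) t - m * flat (m + 1) t)) (at t)"
    proof (rule DERIV_cong)
      show "((\<lambda>t. exp (- 1 / t) / t ^ m) has_real_derivative
          (exp (- 1 / t) * (1 / t\<^sup>2) * t ^ m - exp (- 1 / t) * (m * t ^ (m - 1))) / (t ^ m * t ^ m)) (at t)"
        using 1 by (auto intro!: DERIV_divide derivative_eq_intros simp: power2_eq_square)
      show "(exp (- 1 / t) * (1 / t\<^sup>2) * t ^ m - exp (- 1 / t) * (m * t ^ (m - 1))) / (t ^ m * t ^ m) =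
          flat (m + 2) t - m * flat (m + 1) t"
        using 1 by (cases m) (auto simp: flat_def field_simps power2_eq_square)
    qed
    then show ?thesis
      by (rule has_field_derivative_transform_within_open[where S = "{0<..}"])
         (use 1 in \<open>auto simp: flat_def\<close>)
  next
    case 2
    have "((\<lambda>t. 0) has_real_derivative (flat (m + 2) t - m * flat (m + 1) t)) (at t)"
      using 2 by (auto simp: flat_def)
    then show ?thesis
      by (rule has_field_derivative_transform_within_open[where S = "{..<0}"])
         (use 2 in \<open>auto simp: flat_def\<close>)
  next
    case 3
    \<comment> \<open>The difference quotient of \<open>flat m\<close> at 0 is
      \<open>flat (m + 1)\<close>, whose limit is already known.\<close>
    have "((\<lambda>h. (flat m (0 + h) - flat m 0) / h) \<longlongrightarrow> 0) (at 0)"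
      by (rule Lim_transform_eventually[OF flat_at_0[of "m + 1"]])
         (auto simp: eventually_at_filter flat_def)
    then show ?thesis using 3 by (simp add: DERIV_def flat_def)
  qed
qed

lemma Ck_on_flat: "Ck_on k (flat m) UNIV"
proof (induction k arbitrary: m)
  case 0
  show ?case
    using DERIV_isCont[OF flat_has_real_derivative] by (auto intro: continuous_at_imp_continuous_on)
next
  case (Suc k)
  show ?case
  proof (rule Ck_on_SucI)
    show "(flat m has_derivative (\<lambda>v. (flat (m + 2) x + (- real m) * flat (m + 1) x) * v)) (at x)" for x
      using flat_has_real_derivative[of m x] by (simp add: has_field_derivative_def)
    show "Ck_on k (\<lambda>x. (flat (m + 2) x + (- real m) * flat (m + 1) x) * v) UNIV" for v
      by (intro Ck_on_mult Ck_on_add Ck_on_const Suc open_UNIV)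
  qed simp
qed

lemma smooth_bump_exists:
  fixes a :: "'a::euclidean_space"
  assumes "r > 0"
  obtains \<rho> :: "'a \<Rightarrow> real" where "smooth_on \<rho> UNIV" "\<rho> a = 1" "\<And>u. u \<notin> cball a r \<Longrightarrow> \<rho> u = 0"
proof
  \<comment> \<open>The sum is the squared distance from \<open>u\<close> to \<open>a\<close>, so
    the argument of \<open>flat\<close> is negative outside the closed ball; the leading factor
    normalizes the value at \<open>a\<close>. Differences are written with negated constants to fit
    the rules for sums and products.\<close>
  let ?\<rho> = "\<lambda>u. (1 / flat 0 (r\<^sup>2)) * flat 0 (r\<^sup>2 + (-1) * (\<Sum>b\<in>Basis. ((u + - a) \<bullet> b) * ((u + - a) \<bullet> b)))"
  show "smooth_on ?\<rho> UNIV"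
    unfolding smooth_on_def
    by (intro allI Ck_on_mult[OF open_UNIV] Ck_on_const Ck_on_add[OF open_UNIV] Ck_on_sum[OF open_UNIV]
        Ck_on_inner_right[OF open_UNIV] Ck_on_bounded_linear[OF bounded_linear_ident]
        Ck_on_compose[OF open_UNIV open_UNIV subset_UNIV _ Ck_on_flat])
  have *: "(\<Sum>b\<in>Basis. ((u + - a) \<bullet> b) * ((u + - a) \<bullet> b)) = (dist a u)\<^sup>2" for u
    by (simp add: euclidean_inner[symmetric] dist_norm norm_minus_commute[of a] power2_norm_eq_inner)
  show "?\<rho> a = 1" unfolding * using assms by (simp add: flat_def)
  show "?\<rho> u = 0" if "u \<notin> cball a r" for u
  proof -
    have "r\<^sup>2 < (dist a u)\<^sup>2" using that assms by (intro power_strict_mono) auto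
    then show ?thesis unfolding * by (simp add: flat_def)
  qed
qed

section \<open>Averages along rays and Hadamard's lemma\<close>

lemma ray_in_ball:
  fixes a u :: "'a::real_normed_vector"
  assumes "u \<in> ball a r" "t \<in> {0..1}"
  shows "a + t *\<^sub>R (u - a) \<in> ball a r"
  using assms mult_left_le_one_le[of "norm (u - a)" t]
  by (auto simp: dist_norm norm_minus_commute)

text \<open>The weight \<open>t^m\<close> makes this family of averages closed under differentiation.\<close>

lemma Ck_on_ray_integral:
  fixes F :: "'a::euclidean_space \<Rightarrow> real"
  assumes "Ck_on k F (ball a r)"
  shows "Ck_on k (\<lambda>u. integral {0..1} (\<lambda>t. t ^ m * F (a + t *\<^sub>R (u - a)))) (ball a r)"
  using assms
proof (induction k arbitrary: F m)
  case (0 F m)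
  have "continuous_on (ball a r \<times> {0..1}) (\<lambda>z. F (a + snd z *\<^sub>R (fst z - a)))"
    by (intro continuous_on_compose2[OF 0[unfolded Ck_on.simps]] continuous_intros)
       (use ray_in_ball[of _ a r] in auto)
  then have "continuous_on (ball a r \<times> cbox 0 1) (\<lambda>(u, t). t ^ m * F (a + t *\<^sub>R (u - a)))"
    unfolding cbox_interval case_prod_unfold by (intro continuous_intros)
  from integral_continuous_on_param[OF this] show ?case by (simp only: Ck_on.simps cbox_interval)
next
  case (Suc k F m)
  let ?F' = "\<lambda>u. frechet_derivative F (at u)"
  let ?f = "\<lambda>u t. t ^ m * F (a + t *\<^sub>R (u - a))"
  \<comment> \<open>The chain rule contributes one factor \<open>t\<close>, which raises the power.
    The derivative is packed into the type of bounded linear maps, as differentiation under the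
    integral sign by \<open>leibniz_rule\<close> expects.\<close>
  let ?f' = "\<lambda>u t. (t ^ Suc m) *\<^sub>R Blinfun (?F' (a + t *\<^sub>R (u - a)))"
  have bl: "bounded_linear (?F' u)" if "u \<in> ball a r" for u
    using Ck_on_SucD[OF Suc.prems that] by (rule has_derivative_bounded_linear)
  have contF: "continuous_on (ball a r) F"
    using Suc.prems by (rule Ck_on_imp_continuous)
  have contF': "continuous_on (ball a r) (\<lambda>u. ?F' u v)" for v
  proof -
    have "Ck_on k (\<lambda>u. ?F' u v) (ball a r)" using Suc.prems by auto
    then show ?thesis by (rule Ck_on_imp_continuous)
  qed
  have contf': "continuous_on (ball a r \<times> {0..1}) (\<lambda>(u, t). ?f' u t)"
    unfolding case_prod_unfold
  proof (intro continuous_on_scaleR continuous_on_power continuous_on_snd continuous_on_id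
      continuous_on_blinfun_componentwise)
    fix b :: 'a assume "b \<in> Basis"
    have "continuous_on (ball a r \<times> {0..1}) (\<lambda>z. ?F' (a + snd z *\<^sub>R (fst z - a)) b)"
      by (intro continuous_on_compose2[OF contF'[of b]] continuous_intros)
         (use ray_in_ball[of _ a r] in auto)
    then show "continuous_on (ball a r \<times> {0..1})
        (\<lambda>z. blinfun_apply (Blinfun (?F' (a + snd z *\<^sub>R (fst z - a)))) b)"
      by (rule continuous_on_eq) (use ray_in_ball[of _ a r] in \<open>auto simp: bounded_linear_Blinfun_apply[OF bl]\<close>)
  qed
  have contf'1: "continuous_on {0..1} (?f' u)" if "u \<in> ball a r" for u
  proof -
    have "continuous_on {0..1} (\<lambda>t. (u, t))" "Pair u ` {0..1} \<subseteq> ball a r \<times> {0..1}"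
      using that by (auto intro!: continuous_intros)
    from continuous_on_compose2[OF contf' this] show ?thesis by (simp only: case_prod_conv)
  qed
  have der: "((\<lambda>u. integral (cbox 0 1) (?f u)) has_derivative
      blinfun_apply (integral (cbox 0 1) (?f' u))) (at u within ball a r)" if u: "u \<in> ball a r" for u
  proof (rule leibniz_rule)
    show "((\<lambda>u. ?f u t) has_derivative blinfun_apply (?f' u t)) (at u within ball a r)"
      if "u \<in> ball a r" "t \<in> cbox 0 1" for u t
    proof -
      have ib: "a + t *\<^sub>R (u - a) \<in> ball a r" using ray_in_ball that by (simp add: cbox_interval)
      have "((\<lambda>u. a + t *\<^sub>R (u - a)) has_derivative (\<lambda>v. t *\<^sub>R v)) (at u within ball a r)"
        by (auto intro!: derivative_eq_intros)
      from has_derivative_compose[OF this Ck_on_SucD[OF Suc.prems ib]]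
      have "((\<lambda>u. F (a + t *\<^sub>R (u - a))) has_derivative
          (\<lambda>v. ?F' (a + t *\<^sub>R (u - a)) (t *\<^sub>R v))) (at u within ball a r)" .
      then have "((\<lambda>u. ?f u t) has_derivative
          (\<lambda>v. t ^ m * ?F' (a + t *\<^sub>R (u - a)) (t *\<^sub>R v))) (at u within ball a r)"
        by (rule has_derivative_mult_right)
      moreover have "(\<lambda>v. t ^ m * ?F' (a + t *\<^sub>R (u - a)) (t *\<^sub>R v)) = blinfun_apply (?f' u t)"
        using bl[OF ib]
        by (auto simp: scaleR_blinfun.rep_eq bounded_linear_Blinfun_apply
            linear_scale[OF bounded_linear.linear])
      ultimately show ?thesis by simp
    qed
    show "?f u integrable_on cbox 0 1" if "u \<in> ball a r" for u
      by (intro integrable_continuous continuous_intros continuous_on_compose2[OF contF])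
         (use ray_in_ball[of _ a r] that in \<open>auto simp: cbox_interval\<close>)
  qed (use contf' u in \<open>auto simp: cbox_interval\<close>)
  show ?case
  proof (rule Ck_on_SucI)
    show "((\<lambda>u. integral {0..1} (?f u)) has_derivative
      (\<lambda>v. integral {0..1} (\<lambda>t. t ^ Suc m * ?F' (a + t *\<^sub>R (u - a)) v))) (at u)"
      if u: "u \<in> ball a r" for u
    proof -
      have "blinfun_apply (integral {0..1} (?f' u)) v =
          integral {0..1} (\<lambda>t. t ^ Suc m * ?F' (a + t *\<^sub>R (u - a)) v)" for v
      proof -
        have "blinfun_apply (integral {0..1} (?f' u)) v = integral {0..1} (\<lambda>t. blinfun_apply (?f' u t) v)"
          using integrable_continuous_interval[OF contf'1[OF u]] by (rule blinfun_apply_integral)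
        also have "\<dots> = integral {0..1} (\<lambda>t. t ^ Suc m * ?F' (a + t *\<^sub>R (u - a)) v)"
          by (rule integral_cong)
             (simp add: scaleR_blinfun.rep_eq bounded_linear_Blinfun_apply[OF bl[OF ray_in_ball[OF u]]])
        finally show ?thesis .
      qed
      then have "(\<lambda>v. integral {0..1} (\<lambda>t. t ^ Suc m * ?F' (a + t *\<^sub>R (u - a)) v)) =
          blinfun_apply (integral {0..1} (?f' u))" by auto
      then show ?thesis
        using der[OF u] at_within_open[OF u open_ball] by (simp add: cbox_interval)
    qed
    show "Ck_on k (\<lambda>u. integral {0..1} (\<lambda>t. t ^ Suc m * ?F' (a + t *\<^sub>R (u - a)) v)) (ball a r)" for v
      by (rule Suc.IH) (use Suc.prems in auto)
  qed simp
qed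

text \<open>Fundamental theorem of calculus along the segment from \<open>a\<close> to
  \<open>u\<close>: \<open>G b\<close> is the average over the segment of the derivative of
  \<open>F\<close> in direction \<open>b\<close>, and \<open>Ck_on_ray_integral\<close> with
  \<open>m = 0\<close> makes it smooth.\<close>

lemma hadamard:
  fixes F :: "'a::euclidean_space \<Rightarrow> real"
  assumes "smooth_on F (ball a r)" "r > 0"
  obtains G where "\<And>b. smooth_on (G b) (ball a r)"
    "\<And>b. G b a = frechet_derivative F (at a) b"
    "\<And>u. u \<in> ball a r \<Longrightarrow> F u = F a + (\<Sum>b\<in>Basis. ((u - a) \<bullet> b) * G b u)"
proof
  let ?F' = "\<lambda>u. frechet_derivative F (at u)"
  define G where "G b u = integral {0..1} (\<lambda>t. t ^ 0 * ?F' (a + t *\<^sub>R (u - a)) b)" for b u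
  have C: "Ck_on (Suc k) F (ball a r)" for k using assms smooth_on_def by blast
  then have C': "Ck_on k (\<lambda>u. ?F' u b) (ball a r)" for k b by simp
  show "smooth_on (G b) (ball a r)" for b
    unfolding smooth_on_def G_def using C' Ck_on_ray_integral by blast
  show "G b a = ?F' a b" for b by (simp add: G_def)
  show "F u = F a + (\<Sum>b\<in>Basis. ((u - a) \<bullet> b) * G b u)" if u: "u \<in> ball a r" for u
  proof -
    let ?c = "\<lambda>t. a + t *\<^sub>R (u - a)"
    have int: "(\<lambda>t. ?F' (?c t) b) integrable_on {0..1}" for b
      by (intro integrable_continuous_interval continuous_on_compose2[OF C'[of 0, unfolded Ck_on.simps]]
          continuous_intros) (use ray_in_ball[of _ a r] u in auto)
    have "((\<lambda>t. ?F' (?c t) (u - a)) has_integral (F (?c 1) - F (?c 0))) {0..1}"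
    proof (rule fundamental_theorem_of_calculus)
      fix t :: real assume t: "t \<in> {0..1}"
      have "(?c has_vector_derivative (u - a)) (at t within {0..1})"
        by (auto intro!: derivative_eq_intros)
      from vector_derivative_diff_chain_within[OF this, of F "?F' (?c t)"] 
      show "((\<lambda>t. F (?c t)) has_vector_derivative ?F' (?c t) (u - a)) (at t within {0..1})"
        using Ck_on_SucD[OF C ray_in_ball[OF u t]] has_derivative_at_withinI by (auto simp: o_def)
    qed simp
    then have "F u - F a = integral {0..1} (\<lambda>t. ?F' (?c t) (u - a))"
      by (simp add: integral_unique)
    also have "\<dots> = integral {0..1} (\<lambda>t. \<Sum>b\<in>Basis. ((u - a) \<bullet> b) * ?F' (?c t) b)"
    proof (rule integral_cong)
      fix t :: real assume "t \<in> {0..1}"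
      then have "linear (?F' (?c t))"
        using Ck_on_SucD[OF C ray_in_ball[OF u]] has_derivative_linear by blast
      then show "?F' (?c t) (u - a) = (\<Sum>b\<in>Basis. ((u - a) \<bullet> b) * ?F' (?c t) b)"
        by (rule linear_real_sum_Basis)
    qed
    also have "\<dots> = (\<Sum>b\<in>Basis. ((u - a) \<bullet> b) * G b u)"
      using int by (subst integral_sum) (auto simp: G_def intro!: integrable_on_mult_right)
    finally show ?thesis by simp
  qed
qed

section \<open>Tangent vectors of a smooth manifold\<close>

lemma sum_fun_apply: "sum f I q = (\<Sum>i\<in>I. f i q)"
  for f :: "'i \<Rightarrow> 'a \<Rightarrow> 'b::comm_monoid_add"
  by (induction I rule: infinite_finite_induct) auto

section \<open>Charts and the algebra of smooth functions\<close>

locale smooth_manifold =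
  fixes A :: "('m::{t2_space,second_countable_topology}, 'e::euclidean_space) atlas"
  assumes atlas: "smooth_atlas A"
begin

lemma chart_open: "(U, x) \<in> A \<Longrightarrow> open U" "(U, x) \<in> A \<Longrightarrow> open (x ` U)"
  and chart_homeomorphism: "(U, x) \<in> A \<Longrightarrow> homeomorphism U (x ` U) x (inv_into U x)"
  using atlas[unfolded smooth_atlas_def, THEN conjunct1, THEN bspec, of "(U, x)"] by simp_all

lemma transition_smooth:
  assumes "(U, x) \<in> A" "(W, y) \<in> A"
  shows "smooth_on (y \<circ> inv_into U x) (x ` (U \<inter> W))"
  using bspec[OF bspec[OF atlas[unfolded smooth_atlas_def, THEN conjunct2, THEN conjunct2] assms(1), simplified] assms(2)]
  by simp

lemma chart_around: obtains U x where "(U, x) \<in> A" "p \<in> U"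
proof -
  have "p \<in> (\<Union>(U, x)\<in>A. U)"
    using atlas[unfolded smooth_atlas_def, THEN conjunct2, THEN conjunct1] by simp
  then show ?thesis using that by auto
qed

lemma chart_inv: "(U, x) \<in> A \<Longrightarrow> q \<in> U \<Longrightarrow> inv_into U x (x q) = q"
  using chart_homeomorphism homeomorphism_apply1 by blast

lemma open_chart_image:
  assumes "(U, x) \<in> A" "open N" "N \<subseteq> U"
  shows "open (x ` N)"
proof -
  have "openin (top_of_set (x ` U)) (x ` N)"
    by (rule homeomorphism_imp_open_map[OF chart_homeomorphism[OF assms(1)]])
       (use assms in \<open>auto simp: openin_open_eq chart_open\<close>)
  then show ?thesis
    using chart_open(2)[OF assms(1)] openin_open_trans by blast
qed

lemma smooth_funsD: "f \<in> smooth_funs A \<Longrightarrow> (U, x) \<in> A \<Longrightarrow> Ck_on k (\<lambda>u. f (inv_into U x u)) (x ` U)"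
  unfolding smooth_funs_def smooth_on_def o_def by fast

lemma smooth_funsI:
  "(\<And>U x k. (U, x) \<in> A \<Longrightarrow> Ck_on k (\<lambda>u. f (inv_into U x u)) (x ` U)) \<Longrightarrow> f \<in> smooth_funs A"
  unfolding smooth_funs_def smooth_on_def o_def by fast

lemma smooth_const: "(\<lambda>_. c) \<in> smooth_funs A"
  by (intro smooth_funsI Ck_on_const)

lemma smooth_zero: "0 \<in> smooth_funs A" and smooth_one: "1 \<in> smooth_funs A"
  using smooth_const[of 0] smooth_const[of 1] by (simp_all add: zero_fun_def one_fun_def)

lemma smooth_add: "f \<in> smooth_funs A \<Longrightarrow> k \<in> smooth_funs A \<Longrightarrow> f + k \<in> smooth_funs A"
  unfolding plus_fun_def by (rule smooth_funsI) (intro Ck_on_add smooth_funsD chart_open)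

lemma smooth_mult: "f \<in> smooth_funs A \<Longrightarrow> k \<in> smooth_funs A \<Longrightarrow> f * k \<in> smooth_funs A"
  unfolding times_fun_def by (rule smooth_funsI) (intro Ck_on_mult smooth_funsD chart_open)

lemma smooth_scale: "f \<in> smooth_funs A \<Longrightarrow> c *\<^sub>R f \<in> smooth_funs A"
  using smooth_mult[OF smooth_const[of c], of f] by (simp add: scaleR_fun_def times_fun_def)

lemma smooth_uminus: "f \<in> smooth_funs A \<Longrightarrow> - f \<in> smooth_funs A"
  using smooth_scale[of f "-1"] by simp

lemma smooth_diff: "f \<in> smooth_funs A \<Longrightarrow> k \<in> smooth_funs A \<Longrightarrow> f - k \<in> smooth_funs A"
  using smooth_add[OF _ smooth_uminus, of f k] by simp

lemma smooth_sum: "(\<And>i. i \<in> I \<Longrightarrow> f i \<in> smooth_funs A) \<Longrightarrow> sum f I \<in> smooth_funs A"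
  by (induction I rule: infinite_finite_induct) (auto simp: smooth_zero intro: smooth_add)

lemmas smooth_intros =
  smooth_const smooth_zero smooth_one smooth_add smooth_mult smooth_scale smooth_uminus smooth_diff

text \<open>Around a point of the preimage of \<open>K\<close>, any other chart sees
  \<open>G\<close> composed with a transition map. That preimage is compact, hence closed in a
  Hausdorff space, so every other point has a neighbourhood on which the extension is zero.\<close>

lemma smooth_extension_by_zero:
  assumes U: "(U, x) \<in> A" and S: "open S" "S \<subseteq> x ` U" and K: "compact K" "K \<subseteq> S"
    and G: "smooth_on G S" and zero: "\<And>u. u \<notin> K \<Longrightarrow> G u = 0"
  shows "(\<lambda>q. if q \<in> U then G (x q) else 0) \<in> smooth_funs A" (is "?E \<in> _")
proof (rule smooth_funsI)
  fix W y k assume W: "(W, y) \<in> A"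
  let ?i = "inv_into U x" and ?j = "inv_into W y"
  have closed: "closed (?i ` K)"
  proof (intro compact_imp_closed compact_continuous_image)
    show "continuous_on K ?i"
      using homeomorphism_cont2[OF chart_homeomorphism[OF U]] K S continuous_on_subset by blast
  qed (rule K)
  show "Ck_on k (\<lambda>z. ?E (?j z)) (y ` W)"
  proof (rule Ck_on_local)
    fix z assume "z \<in> y ` W"
    then obtain q where q: "q \<in> W" "z = y q" by auto
    show "\<exists>T. open T \<and> z \<in> T \<and> Ck_on k (\<lambda>z. ?E (?j z)) T"
    proof (cases "q \<in> ?i ` K")
      case True
      define N where "N = W \<inter> (U \<inter> x -` S)"
      have "open (U \<inter> x -` S)"
        using homeomorphism_cont1[OF chart_homeomorphism[OF U]] chart_open(1)[OF U] S(1)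
        by (intro continuous_open_preimage)
      then have N: "open N" "N \<subseteq> W" "N \<subseteq> U" unfolding N_def using chart_open(1)[OF W] by auto
      have oT: "open (y ` N)" using open_chart_image[OF W N(1,2)] .
      obtain u where u: "u \<in> K" "q = ?i u" using True by auto
      then have "u \<in> x ` U" using K S by auto
      then have "x q = u" "q \<in> U" using u by (auto simp: f_inv_into_f inv_into_into)
      then have qN: "q \<in> N" using u K q by (auto simp: N_def)
      have "Ck_on k (\<lambda>z. x (?j z)) (y ` N)"
        using transition_smooth[OF W U] N unfolding smooth_on_def o_def
        by (blast intro: Ck_on_subset)
      then have "Ck_on k (\<lambda>z. G (x (?j z))) (y ` N)"
        using G unfolding smooth_on_def
        by (intro Ck_on_compose[OF oT S(1)]) (use N in \<open>auto simp: N_def chart_inv[OF W]\<close>)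
      then have "Ck_on k (\<lambda>z. ?E (?j z)) (y ` N)"
        by (rule Ck_on_cong[OF oT, rotated]) (use N in \<open>auto simp: chart_inv[OF W] subset_iff\<close>)
      then show ?thesis using oT qN q by blast
    next
      case False
      define N where "N = W - ?i ` K"
      have N: "open N" "N \<subseteq> W" unfolding N_def using chart_open(1)[OF W] closed by auto
      have oT: "open (y ` N)" using open_chart_image[OF W N] .
      have "?E (?j z) = 0" if "z \<in> y ` N" for z
      proof -
        obtain q' where "q' \<in> W" "q' \<notin> ?i ` K" "z = y q'" using \<open>z \<in> y ` N\<close> N_def by auto
        then have "?j z = q'" "q' \<in> U \<Longrightarrow> x q' \<notin> K"
          using chart_inv[OF W] chart_inv[OF U] by (auto simp: image_iff)
        then show ?thesis using zero by simp
      qed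
      then have "Ck_on k (\<lambda>z. ?E (?j z)) (y ` N)"
        by (intro Ck_on_cong[OF oT _ Ck_on_const[of k 0]]) simp
      then show ?thesis using oT False q N_def by blast
    qed
  qed
qed

section \<open>Derivations at a point and their extension to vector fields\<close>

lemma tangent_space_add:
  "v \<in> tangent_space A p \<Longrightarrow> f \<in> smooth_funs A \<Longrightarrow> k \<in> smooth_funs A \<Longrightarrow> v (f + k) = v f + v k"
  and tangent_space_mult:
  "v \<in> tangent_space A p \<Longrightarrow> f \<in> smooth_funs A \<Longrightarrow> k \<in> smooth_funs A \<Longrightarrow> v (f * k) = f p * v k + k p * v f"
  and tangent_space_scale: "v \<in> tangent_space A p \<Longrightarrow> f \<in> smooth_funs A \<Longrightarrow> v (c *\<^sub>R f) = c * v f"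
  and tangent_space_nonsmooth: "v \<in> tangent_space A p \<Longrightarrow> f \<notin> smooth_funs A \<Longrightarrow> v f = 0"
  unfolding tangent_space_def by blast+

lemma tangent_space_zero: "v \<in> tangent_space A p \<Longrightarrow> v 0 = 0"
  using tangent_space_scale[OF _ smooth_zero, of v p 0] by simp

lemma tangent_space_sum:
  "v \<in> tangent_space A p \<Longrightarrow> (\<And>i. i \<in> I \<Longrightarrow> f i \<in> smooth_funs A) \<Longrightarrow> v (sum f I) = (\<Sum>i\<in>I. v (f i))"
  by (induction I rule: infinite_finite_induct)
     (auto simp: tangent_space_zero tangent_space_add smooth_sum)

lemma tangent_space_one: "v \<in> tangent_space A p \<Longrightarrow> v 1 = 0"
  using tangent_space_mult[OF _ smooth_one smooth_one, of v p] by simp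

text \<open>Turns functions of the coordinates near \<open>p\<close> into global smooth functions.
  The bump is supported in the closed ball of half the radius, a compact subset of the open ball on
  which \<open>G\<close> is smooth.\<close>

lemma chart_cutoff:
  assumes U: "(U, x) \<in> A" "p \<in> U"
  obtains r \<rho> where "r > 0" "ball (x p) r \<subseteq> x ` U" "smooth_on \<rho> UNIV" "\<rho> (x p) = 1"
    "\<And>u. u \<notin> ball (x p) r \<Longrightarrow> \<rho> u = 0"
    "\<And>G. smooth_on G (ball (x p) r) \<Longrightarrow> (\<lambda>q. if q \<in> U then \<rho> (x q) * G (x q) else 0) \<in> smooth_funs A"
proof -
  let ?a = "x p"
  have "?a \<in> x ` U" using U by auto
  then obtain r where r: "r > 0" "ball ?a r \<subseteq> x ` U"
    using chart_open(2)[OF U(1)] open_contains_ball by blast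
  obtain \<rho> :: "'e \<Rightarrow> real" where \<rho>: "smooth_on \<rho> UNIV" "\<rho> ?a = 1" "\<And>u. u \<notin> cball ?a (r/2) \<Longrightarrow> \<rho> u = 0"
    using smooth_bump_exists[of "r/2" ?a] r by auto
  have sub: "cball ?a (r/2) \<subseteq> ball ?a r" using r(1) by auto
  have "(\<lambda>q. if q \<in> U then \<rho> (x q) * G (x q) else 0) \<in> smooth_funs A" if "smooth_on G (ball ?a r)" for G
  proof (rule smooth_extension_by_zero[OF U(1) open_ball r(2) compact_cball sub])
    show "smooth_on (\<lambda>u. \<rho> u * G u) (ball ?a r)"
      using that \<rho>(1) unfolding smooth_on_def
      by (intro allI Ck_on_mult) (auto intro: Ck_on_subset)
  qed (use \<rho> in auto)
  then show ?thesis using that[of r \<rho>] r \<rho> sub by blast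
qed

lemma smooth_on_centered_inner: "smooth_on (\<lambda>u. (u - a) \<bullet> b) S" for a b :: "'z::euclidean_space"
proof -
  have "Ck_on k (\<lambda>u. (u + - a) \<bullet> b) UNIV" for k
    by (intro Ck_on_inner_right Ck_on_add open_UNIV Ck_on_const Ck_on_bounded_linear[OF bounded_linear_ident])
  then have "Ck_on k (\<lambda>u. (u - a) \<bullet> b) UNIV" for k by simp
  then show ?thesis unfolding smooth_on_def using Ck_on_subset by blast
qed

abbreviation chart_deriv :: "'m set \<Rightarrow> ('m \<Rightarrow> 'e) \<Rightarrow> ('m \<Rightarrow> real) \<Rightarrow> 'm \<Rightarrow> 'e \<Rightarrow> real" where
  "chart_deriv U x f q \<equiv> frechet_derivative (\<lambda>u. f (inv_into U x u)) (at (x q))"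

lemma chart_deriv:
  assumes "(U, x) \<in> A" "q \<in> U" "f \<in> smooth_funs A"
  shows "((\<lambda>u. f (inv_into U x u)) has_derivative chart_deriv U x f q) (at (x q))"
  using Ck_on_SucD[OF smooth_funsD[OF assms(3,1)]] assms(2) by blast

text \<open>Additivity and the Leibniz rule are inherited from the Frechet derivative. The scalar
  \<open>s\<close> leaves room for the value of a cutoff, the set \<open>B\<close> for a single
  coordinate direction.\<close>

lemma coordinate_derivation:
  assumes U: "(U, x) \<in> A" "q \<in> U"
  shows "(\<lambda>f. if f \<in> smooth_funs A then s * (\<Sum>b\<in>B. c b * chart_deriv U x f q b) else 0)
    \<in> tangent_space A q"
proof -
  note d = chart_deriv[OF U]
  have "chart_deriv U x (f + k) q = (\<lambda>b. chart_deriv U x f q b + chart_deriv U x k q b)"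
    if "f \<in> smooth_funs A" "k \<in> smooth_funs A" for f k
    using frechet_derivative_at[OF has_derivative_add[OF d d, OF that]] by simp
  moreover have "chart_deriv U x (f * k) q = (\<lambda>b. f q * chart_deriv U x k q b + chart_deriv U x f q b * k q)"
    if "f \<in> smooth_funs A" "k \<in> smooth_funs A" for f k
    using frechet_derivative_at[OF has_derivative_mult[OF d d, OF that]] by (simp add: chart_inv[OF U])
  moreover have "chart_deriv U x (t *\<^sub>R f) q = (\<lambda>b. t * chart_deriv U x f q b)"
    if "f \<in> smooth_funs A" for f t
    using frechet_derivative_at[OF has_derivative_mult_right[OF d, OF that, of t]]
    by (simp add: scaleR_fun_def)
  ultimately show ?thesis
    by (simp add: tangent_space_def smooth_intros)
       (simp add: algebra_simps sum.distrib sum_distrib_left)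
qed

text \<open>Hadamard's lemma shows that \<open>v\<close> is a combination of coordinate derivatives,
  with coefficients the values of \<open>v\<close> on the cut-off coordinates. Keeping these
  coefficients constant over the chart and multiplying by the cutoff, which is 1 at
  \<open>p\<close>, gives a global field.\<close>

lemma tangent_vector_extends:
  assumes v: "v \<in> tangent_space A p"
  obtains X where "X \<in> vector_fields A" "X p = v"
proof -
  obtain U x where U: "(U, x) \<in> A" "p \<in> U" by (rule chart_around)
  define a where "a = x p"
  obtain r \<rho> where r: "r > 0" "ball a r \<subseteq> x ` U" and \<rho>: "smooth_on \<rho> UNIV" "\<rho> a = 1"
    "\<And>u. u \<notin> ball a r \<Longrightarrow> \<rho> u = 0"
    and cut: "\<And>G. smooth_on G (ball a r) \<Longrightarrow> (\<lambda>q. if q \<in> U then \<rho> (x q) * G (x q) else 0) \<in> smooth_funs A"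
    by (rule chart_cutoff[OF U, folded a_def]) (rule that)
  note sub = r(2)
  let ?i = "inv_into U x"
  define E where "E G = (\<lambda>q. if q \<in> U then \<rho> (x q) * G (x q) else 0)" for G
  have E_smooth: "E G \<in> smooth_funs A" if "smooth_on G (ball a r)" for G
    unfolding E_def using that by (rule cut)
  have E_p: "E G p = G a" for G using U \<rho> by (simp add: E_def a_def)
  define c where "c b = v (E (\<lambda>u. (u - a) \<bullet> b))" for b
  let ?D = "\<lambda>f u. frechet_derivative (\<lambda>u. f (?i u)) (at u)"
  have v_eq: "v f = (\<Sum>b\<in>Basis. c b * ?D f a b)" if f: "f \<in> smooth_funs A" for f
  proof -
    let ?F = "\<lambda>u. f (?i u)"
    have "smooth_on ?F (ball a r)"
      using smooth_funsD[OF f U(1)] sub unfolding smooth_on_def by (blast intro: Ck_on_subset)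
    from hadamard[OF this r(1)] obtain G where G: "\<And>b. smooth_on (G b) (ball a r)"
      "\<And>b. G b a = ?D f a b"
      "\<And>u. u \<in> ball a r \<Longrightarrow> ?F u = ?F a + (\<Sum>b\<in>Basis. ((u - a) \<bullet> b) * G b u)" by blast
    have Fa: "?F a = f p" using chart_inv U by (simp add: a_def)
    define P where "P = E (\<lambda>_. 1)"
    define L where "L b = E (\<lambda>u. (u - a) \<bullet> b)" for b
    have P: "P \<in> smooth_funs A" unfolding P_def
      by (rule E_smooth) (simp add: smooth_on_def Ck_on_const)
    have L: "L b \<in> smooth_funs A" for b unfolding L_def by (rule E_smooth smooth_on_centered_inner)+
    have Q: "E (G b) \<in> smooth_funs A" for b by (rule E_smooth G)+
    \<comment> \<open>The Hadamard expansion is only local, while \<open>v\<close> acts on global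
      functions. Multiplying by the square of the cutoff globalizes it: in the sum one factor goes
      to the coordinate and one to \<open>G b\<close>.\<close>
    have id: "f * (P * P) = f p *\<^sub>R (P * P) + (\<Sum>b\<in>Basis. L b * E (G b))"
    proof
      fix q
      show "(f * (P * P)) q = (f p *\<^sub>R (P * P) + (\<Sum>b\<in>Basis. L b * E (G b))) q"
      proof (cases "q \<in> U \<and> x q \<in> ball a r")
        case True
        have "f q = f p + (\<Sum>b\<in>Basis. ((x q - a) \<bullet> b) * G b (x q))"
          using G(3)[of "x q"] True Fa chart_inv[OF U(1), of q] by simp
        then have "f q * (\<rho> (x q) * \<rho> (x q)) =
            f p * (\<rho> (x q) * \<rho> (x q)) + (\<Sum>b\<in>Basis. (\<rho> (x q) * ((x q - a) \<bullet> b)) * (\<rho> (x q) * G b (x q)))"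
          by (simp add: algebra_simps sum_distrib_left)
        then show ?thesis using True
          by (simp add: P_def L_def E_def scaleR_fun_def sum_fun_apply)
      next
        case False
        then have "q \<notin> U \<or> \<rho> (x q) = 0" using \<rho>(3) by blast
        then have "P q = 0" "L b q = 0" for b by (auto simp: P_def L_def E_def)
        then show ?thesis by (simp add: scaleR_fun_def sum_fun_apply)
      qed
    qed
    \<comment> \<open>As \<open>P\<close> is 1 at \<open>p\<close>, the same term
      \<open>f p * v (P * P)\<close> arises on both sides of \<open>id\<close> and cancels.\<close>
    have "v (f * (P * P)) = f p * v (P * P) + v f"
      by (simp add: tangent_space_mult[OF v f] smooth_mult P) (simp add: P_def E_p)
    moreover have "v (f p *\<^sub>R (P * P) + (\<Sum>b\<in>Basis. L b * E (G b))) =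
        f p * v (P * P) + (\<Sum>b\<in>Basis. c b * ?D f a b)"
    proof -
      \<comment> \<open>\<open>L b\<close> vanishes at \<open>p\<close>, so only the Leibniz term
        that differentiates \<open>L b\<close> survives.\<close>
      have "v (L b * E (G b)) = c b * ?D f a b" for b
        by (simp add: tangent_space_mult[OF v L Q]) (simp add: L_def E_p c_def G)
      then show ?thesis
        by (simp add: tangent_space_add[OF v] tangent_space_sum[OF v] tangent_space_scale[OF v]
            smooth_intros smooth_sum P L Q)
    qed
    ultimately show ?thesis unfolding id by simp
  qed
  define X where "X q f =
    (if q \<in> U \<and> f \<in> smooth_funs A then \<rho> (x q) * (\<Sum>b\<in>Basis. c b * ?D f (x q) b) else 0)" for q f
  have "X q \<in> tangent_space A q" for q
  proof (cases "q \<in> U")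
    case False
    then show ?thesis by (simp add: tangent_space_def X_def)
  next
    case True
    then show ?thesis
      using coordinate_derivation[OF U(1) True, of "\<rho> (x q)" c Basis] by (simp add: X_def[abs_def])
  qed
  moreover have "vderiv X f \<in> smooth_funs A" if f: "f \<in> smooth_funs A" for f
  proof -
    have "Ck_on (Suc k) (\<lambda>u. f (?i u)) (ball a r)" for k
      using smooth_funsD[OF f U(1)] sub by (blast intro: Ck_on_subset)
    then have "smooth_on (\<lambda>u. \<Sum>b\<in>Basis. c b * ?D f u b) (ball a r)"
      unfolding smooth_on_def by (intro allI Ck_on_sum Ck_on_mult open_ball Ck_on_const) auto
    then have "E (\<lambda>u. \<Sum>b\<in>Basis. c b * ?D f u b) \<in> smooth_funs A" by (rule E_smooth)
    then show ?thesis using f by (simp add: E_def vderiv_def X_def cong: if_cong)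
  qed
  moreover have "X p = v"
  proof
    show "X p f = v f" for f
      using U \<rho>(2) v_eq tangent_space_nonsmooth[OF v] by (auto simp: X_def a_def)
  qed
  ultimately show ?thesis using that[of X] by (simp add: vector_fields_def)
qed

text \<open>A coordinate derivation at \<open>p\<close> is extended to a field; it is nonzero
  because it maps the matching cut-off coordinate function to 1. This supplies the perturbation in
  the proof that the metric is nonnegative.\<close>

lemma nonvanishing_vector_field:
  obtains X where "X \<in> vector_fields A" "X p \<noteq> 0"
proof -
  obtain U x where U: "(U, x) \<in> A" "p \<in> U" by (rule chart_around)
  obtain b :: 'e where b: "b \<in> Basis" by (meson nonempty_Basis ex_in_conv)
  define v where "v = (\<lambda>f. if f \<in> smooth_funs A then 1 * (\<Sum>c\<in>{b}. 1 * chart_deriv U x f p c) else 0)"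
  have v: "v \<in> tangent_space A p" unfolding v_def by (rule coordinate_derivation[OF U])
  obtain r \<rho> where r: "r > 0" "ball (x p) r \<subseteq> x ` U" and \<rho>: "smooth_on \<rho> UNIV" "\<rho> (x p) = 1"
    and cut: "\<And>G. smooth_on G (ball (x p) r) \<Longrightarrow> (\<lambda>q. if q \<in> U then \<rho> (x q) * G (x q) else 0) \<in> smooth_funs A"
    by (rule chart_cutoff[OF U]) (rule that)
  define f where "f q = (if q \<in> U then \<rho> (x q) * ((x q - x p) \<bullet> b) else 0)" for q
  have f: "f \<in> smooth_funs A" unfolding f_def[abs_def] by (rule cut[OF smooth_on_centered_inner])
  have "Ck_on (Suc 0) \<rho> UNIV" using \<rho>(1) smooth_on_def by blast
  from Ck_on_SucD[OF this UNIV_I]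
  have "((\<lambda>u. \<rho> u * ((u - x p) \<bullet> b)) has_derivative
      (\<lambda>h. \<rho> (x p) * (h \<bullet> b) + frechet_derivative \<rho> (at (x p)) h * ((x p - x p) \<bullet> b))) (at (x p))"
    by (rule has_derivative_mult) (auto intro!: derivative_eq_intros)
  \<comment> \<open>The coordinate factor vanishes at \<open>x p\<close>, so the derivative of the
    cutoff drops out.\<close>
  then have "((\<lambda>u. \<rho> u * ((u - x p) \<bullet> b)) has_derivative (\<lambda>h. h \<bullet> b)) (at (x p))"
    by (simp add: \<rho>(2))
  then have "((\<lambda>u. f (inv_into U x u)) has_derivative (\<lambda>h. h \<bullet> b)) (at (x p))"
  proof (rule has_derivative_transform_within_open)
    show "open (x ` U)" by (rule chart_open(2)[OF U(1)])
    show "x p \<in> x ` U" using U(2) by blast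
    fix u assume "u \<in> x ` U"
    then obtain q where "q \<in> U" "u = x q" by blast
    then show "\<rho> u * ((u - x p) \<bullet> b) = f (inv_into U x u)"
      by (simp add: f_def chart_inv[OF U(1)])
  qed
  from frechet_derivative_at[OF this] have "v f = b \<bullet> b"
    using f by (simp add: v_def flip: \<open>(\<lambda>h. h \<bullet> b) = _\<close>)
  then have "v \<noteq> 0" using b by auto
  then show ?thesis using tangent_vector_extends[OF v] that by metis
qed

end

section \<open>Vector fields, tensors and metrics\<close>

lemma scaleR_fun_apply [simp]: "(c *\<^sub>R f) x = c *\<^sub>R f x"
  by (simp add: scaleR_fun_def)

lemma fscale_simps [simp]:
  "0 \<odot> X = 0" "1 \<odot> X = X" "f \<odot> 0 = 0" "f \<odot> (k \<odot> X) = (f * k) \<odot> X"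
  "f \<odot> (- X) = - (f \<odot> X)" "(- f) \<odot> X = - (f \<odot> X)"
  by (simp_all add: fscale_def fun_eq_iff)

lemma fscale_add: "f \<odot> (X + Y) = f \<odot> X + f \<odot> Y"
  and fscale_diff: "f \<odot> (X - Y) = f \<odot> X - f \<odot> Y"
  by (simp_all add: fscale_def fun_eq_iff algebra_simps)

lemma vderiv_simps [simp]:
  "vderiv 0 f = 0" "vderiv (X + Y) f = vderiv X f + vderiv Y f"
  "vderiv (X - Y) f = vderiv X f - vderiv Y f" "vderiv (- X) f = - vderiv X f"
  "vderiv (k \<odot> X) f = k * vderiv X f"
  "vderiv (bracket X Y) f = vderiv X (vderiv Y f) - vderiv Y (vderiv X f)"
  by (simp_all add: vderiv_def fscale_def bracket_def fun_eq_iff)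

lemma vderiv_ext: "(\<And>f. vderiv X f = vderiv Y f) \<Longrightarrow> X = Y"
  by (simp add: vderiv_def fun_eq_iff)

context smooth_manifold
begin

lemma vector_fieldD: "X \<in> vector_fields A \<Longrightarrow> X p \<in> tangent_space A p"
  and smooth_vderiv: "X \<in> vector_fields A \<Longrightarrow> f \<in> smooth_funs A \<Longrightarrow> vderiv X f \<in> smooth_funs A"
  by (auto simp: vector_fields_def)

lemma vderiv_nonsmooth: "X \<in> vector_fields A \<Longrightarrow> f \<notin> smooth_funs A \<Longrightarrow> vderiv X f = 0"
  using tangent_space_nonsmooth[OF vector_fieldD] by (simp add: vderiv_def fun_eq_iff)

lemma vderiv_add:
  "X \<in> vector_fields A \<Longrightarrow> f \<in> smooth_funs A \<Longrightarrow> k \<in> smooth_funs A \<Longrightarrow>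
    vderiv X (f + k) = vderiv X f + vderiv X k"
  and vderiv_mult:
  "X \<in> vector_fields A \<Longrightarrow> f \<in> smooth_funs A \<Longrightarrow> k \<in> smooth_funs A \<Longrightarrow>
    vderiv X (f * k) = f * vderiv X k + k * vderiv X f"
  and vderiv_scale:
  "X \<in> vector_fields A \<Longrightarrow> f \<in> smooth_funs A \<Longrightarrow> vderiv X (c *\<^sub>R f) = c *\<^sub>R vderiv X f"
  and vderiv_one: "X \<in> vector_fields A \<Longrightarrow> vderiv X 1 = 0"
  and vderiv_zero: "X \<in> vector_fields A \<Longrightarrow> vderiv X 0 = 0"
  by (simp_all add: vderiv_def fun_eq_iff tangent_space_add[OF vector_fieldD] tangent_space_mult[OF vector_fieldD]
      tangent_space_one[OF vector_fieldD] tangent_space_zero[OF vector_fieldD]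
      tangent_space_scale[OF vector_fieldD])

lemma vderiv_uminus:
  "X \<in> vector_fields A \<Longrightarrow> f \<in> smooth_funs A \<Longrightarrow> vderiv X (- f) = - vderiv X f"
  using vderiv_scale[of X f "-1"] by simp

text \<open>Restates the pointwise derivation laws as identities between functions, which can be
  proved by ring algebra.\<close>

lemma vector_fieldI:
  assumes "\<And>f. f \<in> smooth_funs A \<Longrightarrow> vderiv X f \<in> smooth_funs A"
    and "\<And>f. f \<notin> smooth_funs A \<Longrightarrow> vderiv X f = 0"
    and "\<And>f k. f \<in> smooth_funs A \<Longrightarrow> k \<in> smooth_funs A \<Longrightarrow> vderiv X (f + k) = vderiv X f + vderiv X k"
    and "\<And>f k. f \<in> smooth_funs A \<Longrightarrow> k \<in> smooth_funs A \<Longrightarrow> vderiv X (f * k) = f * vderiv X k + k * vderiv X f"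
    and "\<And>f c. f \<in> smooth_funs A \<Longrightarrow> vderiv X (c *\<^sub>R f) = c *\<^sub>R vderiv X f"
  shows "X \<in> vector_fields A"
  using assms unfolding vector_fields_def tangent_space_def
  by (simp add: vderiv_def fun_eq_iff)

lemma vector_field_add: "X \<in> vector_fields A \<Longrightarrow> Y \<in> vector_fields A \<Longrightarrow> X + Y \<in> vector_fields A"
  by (rule vector_fieldI)
     (simp_all add: smooth_add smooth_vderiv vderiv_nonsmooth vderiv_add vderiv_mult vderiv_scale
       scaleR_add_right algebra_simps)

lemma vector_field_fscale:
  assumes "f \<in> smooth_funs A" "X \<in> vector_fields A" shows "f \<odot> X \<in> vector_fields A"
  using assms
  by (intro vector_fieldI)
     (simp_all add: smooth_mult smooth_vderiv vderiv_nonsmooth vderiv_add vderiv_mult vderiv_scale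
       algebra_simps, simp add: fun_eq_iff)

lemma vector_field_uminus: "X \<in> vector_fields A \<Longrightarrow> - X \<in> vector_fields A"
  using vector_field_fscale[OF smooth_uminus[OF smooth_one], of X] by simp

lemma vector_field_diff: "X \<in> vector_fields A \<Longrightarrow> Y \<in> vector_fields A \<Longrightarrow> X - Y \<in> vector_fields A"
  using vector_field_add[OF _ vector_field_uminus, of X Y] by simp

lemma vector_field_zero: "0 \<in> vector_fields A"
  by (rule vector_fieldI) (simp_all add: smooth_zero)

lemma vector_field_scaleR: "X \<in> vector_fields A \<Longrightarrow> c *\<^sub>R X \<in> vector_fields A"
  using vector_field_fscale[OF smooth_const[of c], of X] by (simp add: fscale_def scaleR_fun_def)

lemma vector_field_bracket:
  assumes "X \<in> vector_fields A" "Y \<in> vector_fields A" shows "bracket X Y \<in> vector_fields A"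
  using assms
  by (intro vector_fieldI)
     (simp_all add: smooth_mult smooth_add smooth_scale smooth_diff smooth_vderiv vderiv_nonsmooth vderiv_add vderiv_mult vderiv_scale
       vderiv_zero algebra_simps)

lemmas vector_field_intros = vector_field_add vector_field_fscale vector_field_uminus
  vector_field_diff vector_field_zero vector_field_scaleR vector_field_bracket

text \<open>Both fields take the default value 0 on non-smooth functions, so testing on smooth ones
  gives equality in HOL.\<close>

lemma vector_field_eqI:
  assumes "X \<in> vector_fields A" "Y \<in> vector_fields A"
    and "\<And>f. f \<in> smooth_funs A \<Longrightarrow> vderiv X f = vderiv Y f"
  shows "X = Y"
  using assms vderiv_nonsmooth by (metis vderiv_ext)

lemma bracket_add_right:
  "X \<in> vector_fields A \<Longrightarrow> Y \<in> vector_fields A \<Longrightarrow> Z \<in> vector_fields A \<Longrightarrow>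
    bracket X (Y + Z) = bracket X Y + bracket X Z"
  by (rule vector_field_eqI) (simp_all add: vector_field_intros vderiv_add smooth_vderiv)

lemma bracket_fscale_right:
  "X \<in> vector_fields A \<Longrightarrow> Y \<in> vector_fields A \<Longrightarrow> f \<in> smooth_funs A \<Longrightarrow>
    bracket X (f \<odot> Y) = vderiv X f \<odot> Y + f \<odot> bracket X Y"
  by (rule vector_field_eqI)
     (simp_all add: vector_field_intros vderiv_mult smooth_vderiv algebra_simps)

lemma bracket_uminus_right:
  "X \<in> vector_fields A \<Longrightarrow> Y \<in> vector_fields A \<Longrightarrow> bracket X (- Y) = - bracket X Y"
  by (rule vector_field_eqI) (simp_all add: vector_field_intros vderiv_uminus smooth_vderiv)

lemma bracket_diff_right:
  "X \<in> vector_fields A \<Longrightarrow> Y \<in> vector_fields A \<Longrightarrow> Z \<in> vector_fields A \<Longrightarrow>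
    bracket X (Y - Z) = bracket X Y - bracket X Z"
  using bracket_add_right[of X Y "- Z"] by (simp add: bracket_uminus_right vector_field_uminus)

lemma bracket_swap: "bracket X Y = - bracket Y X"
  by (rule vderiv_ext) simp

lemma bracket_self: "bracket X X = 0"
  by (rule vderiv_ext) simp

lemma bracket_fscale_left:
  "X \<in> vector_fields A \<Longrightarrow> Y \<in> vector_fields A \<Longrightarrow> f \<in> smooth_funs A \<Longrightarrow>
    bracket (f \<odot> X) Y = f \<odot> bracket X Y - vderiv Y f \<odot> X"
  by (subst (1 2) bracket_swap) (simp add: bracket_fscale_right)

section \<open>One-forms, (0,2)-tensors and the trace\<close>

lemma one_form_add:
    "one_form A \<omega> \<Longrightarrow> X \<in> vector_fields A \<Longrightarrow> Y \<in> vector_fields A \<Longrightarrow> \<omega> (X + Y) = \<omega> X + \<omega> Y"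
  and one_form_fscale:
    "one_form A \<omega> \<Longrightarrow> f \<in> smooth_funs A \<Longrightarrow> X \<in> vector_fields A \<Longrightarrow> \<omega> (f \<odot> X) = f * \<omega> X"
  and one_form_smooth: "one_form A \<omega> \<Longrightarrow> X \<in> vector_fields A \<Longrightarrow> \<omega> X \<in> smooth_funs A"
  unfolding one_form_def by blast+

lemma one_form_zero: "one_form A \<omega> \<Longrightarrow> \<omega> 0 = 0"
  using one_form_fscale[OF _ smooth_zero vector_field_zero] by (simp add: fun_eq_iff)

lemma one_form_uminus: "one_form A \<omega> \<Longrightarrow> X \<in> vector_fields A \<Longrightarrow> \<omega> (- X) = - \<omega> X"
  using one_form_fscale[OF _ smooth_uminus[OF smooth_one], of \<omega> X] by simp

lemma one_form_diff:
  "one_form A \<omega> \<Longrightarrow> X \<in> vector_fields A \<Longrightarrow> Y \<in> vector_fields A \<Longrightarrow> \<omega> (X - Y) = \<omega> X - \<omega> Y"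
  using one_form_add[of \<omega> X "- Y"] one_form_uminus[of \<omega> Y] vector_field_uminus[of Y] by simp

lemmas one_form_simps =
  one_form_add one_form_fscale one_form_smooth one_form_zero one_form_uminus one_form_diff

lemma tensor02_right: "tensor02 A T \<Longrightarrow> X \<in> vector_fields A \<Longrightarrow> one_form A (\<lambda>Y. T X Y)"
  and tensor02_left: "tensor02 A T \<Longrightarrow> X \<in> vector_fields A \<Longrightarrow> one_form A (\<lambda>Y. T Y X)"
  unfolding tensor02_def by blast+

text \<open>When a slot is scaled by \<open>f\<close>, the derivative of \<open>f\<close> along
  \<open>V\<close> from the product rule cancels the one from the bracket. This makes it possible to
  expand \<open>lie02 \<xi> g\<close> slot by slot when it is differentiated again.\<close>

lemma tensor02_lie02:
  assumes T: "tensor02 A T" and V: "V \<in> vector_fields A"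
  shows "tensor02 A (lie02 V T)"
proof -
  note T_simps = one_form_simps[OF tensor02_left[OF T]] one_form_simps[OF tensor02_right[OF T]]
  note rules = bracket_add_right bracket_fscale_right vector_field_intros smooth_vderiv V T_simps
      smooth_intros vderiv_add vderiv_mult
  have smooth: "lie02 V T X Y \<in> smooth_funs A" if "X \<in> vector_fields A" "Y \<in> vector_fields A" for X Y
    unfolding lie02_def using that by (simp add: rules)
  have add: "lie02 V T X (Y + Z) = lie02 V T X Y + lie02 V T X Z"
    "lie02 V T (Y + Z) X = lie02 V T Y X + lie02 V T Z X"
    if "X \<in> vector_fields A" "Y \<in> vector_fields A" "Z \<in> vector_fields A" for X Y Z
    unfolding lie02_def using that by (simp_all add: rules)
  have scale: "lie02 V T X (f \<odot> Y) = f * lie02 V T X Y"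
    "lie02 V T (f \<odot> Y) X = f * lie02 V T Y X"
    if "X \<in> vector_fields A" "Y \<in> vector_fields A" "f \<in> smooth_funs A" for X Y f
    unfolding lie02_def using that by (simp_all add: rules) (simp_all add: algebra_simps)
  show ?thesis
    unfolding tensor02_def one_form_def using smooth add scale by blast
qed

text \<open>The field that \<open>tensor11_at\<close> selects with \<open>SOME\<close> is a genuine
  one only because every tangent vector extends to a vector field; then each diagonal entry is the
  representation of 0. Likewise a maximal independent subset justifies the choice of
  \<open>B\<close>.\<close>

lemma trace11_eq_0:
  assumes "\<And>X. X \<in> vector_fields A \<Longrightarrow> S X p = 0"
  shows "trace11 A S p = 0"
proof -
  let ?W = "tangent_space A p"
  define B where "B = (SOME B. B \<subseteq> ?W \<and> independent B \<and> ?W \<subseteq> span B)"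
  have "\<exists>B. B \<subseteq> ?W \<and> independent B \<and> ?W \<subseteq> span B"
    by (rule maximal_independent_subset[of ?W]) (intro exI conjI)
  then have B: "B \<subseteq> ?W" unfolding B_def by (rule someI2_ex) (rule conjunct1)
  have "tensor11_at A S p v = 0" if v: "v \<in> ?W" for v
  proof -
    have "\<exists>X. X \<in> vector_fields A \<and> X p = v" using tangent_vector_extends[OF v] by metis
    then have "(SOME X. X \<in> vector_fields A \<and> X p = v) \<in> vector_fields A"
      by (rule someI2_ex) (rule conjunct1)
    then show ?thesis unfolding tensor11_at_def by (rule assms)
  qed
  then have "(\<Sum>b\<in>B. representation B (tensor11_at A S p b) b) = 0"
    using B by (intro sum.neutral) (auto simp: representation_zero)
  then show ?thesis by (simp add: trace11_def trace_on_def B_def Let_def)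
qed

end

section \<open>Positivity of the metric and the gradient\<close>

locale riemannian_manifold = smooth_manifold A
  for A :: "('m::{t2_space,second_countable_topology}, 'e::euclidean_space) atlas" +
  fixes g :: "'m form2"
  assumes metric: "riemannian_metric A g"
begin

lemma metric_tensor: "tensor02 A g"
  and metric_sym: "X \<in> vector_fields A \<Longrightarrow> Y \<in> vector_fields A \<Longrightarrow> g X Y = g Y X"
  and metric_pos: "X \<in> vector_fields A \<Longrightarrow> X p \<noteq> 0 \<Longrightarrow> g X X p > 0"
  using metric by (auto simp: riemannian_metric_def)

lemmas metric_simps = one_form_simps[OF tensor02_left[OF metric_tensor]]
  one_form_simps[OF tensor02_right[OF metric_tensor]]

text \<open>At a zero of \<open>X\<close> the metric axioms give no sign directly, so \<open>X\<close> is perturbed by a field that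
  does not vanish there.\<close>

lemma metric_nonneg:
  assumes X: "X \<in> vector_fields A" shows "g X X p \<ge> 0"
proof (cases "X p = 0")
  case True
  obtain W where W: "W \<in> vector_fields A" "W p \<noteq> 0" by (rule nonvanishing_vector_field)
  have pos: "g X X p + t * (2 * g X W p + t * g W W p) > 0" if "t > 0" for t
  proof -
    define Z where "Z = X + (\<lambda>_. t) \<odot> W"
    have Z: "Z \<in> vector_fields A" unfolding Z_def by (intro vector_field_intros smooth_const X W)
    have "Z p \<noteq> 0" using W True that by (simp add: Z_def fscale_def)
    have "g Z Z p = g X X p + t * (2 * g X W p + t * g W W p)"
      using X W by (simp add: Z_def metric_simps vector_field_intros smooth_const
          metric_sym[OF W(1) X] algebra_simps)
    with metric_pos[OF Z \<open>Z p \<noteq> 0\<close>] show ?thesis by simp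
  qed
  have "((\<lambda>t. g X X p + t * (2 * g X W p + t * g W W p)) \<longlongrightarrow>
      g X X p + 0 * (2 * g X W p + 0 * g W W p)) (at_right 0)"
    by (intro tendsto_intros)
  then have "0 \<le> g X X p + 0 * (2 * g X W p + 0 * g W W p)"
    by (rule tendsto_lowerbound)
       (use pos in \<open>auto simp: eventually_at_filter intro!: always_eventually less_imp_le\<close>)
  then show ?thesis by simp
qed (use metric_pos[OF X] in \<open>simp add: less_imp_le\<close>)

lemma metric_zeroD:
  assumes "X \<in> vector_fields A" "g X X = 0" shows "X = 0"
  using assms metric_pos by (metis ext less_irrefl zero_fun_apply)

text \<open>The difference of two candidates is orthogonal to every field, itself included, so it is
  zero and the definite description is met by \<open>Z\<close>.\<close>

lemma grad_eqI:
  assumes Z: "Z \<in> vector_fields A" "\<And>X. X \<in> vector_fields A \<Longrightarrow> g Z X = vderiv X f"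
  shows "grad A g f = Z"
  unfolding grad_def
proof (rule the_equality)
  fix W assume W: "W \<in> vector_fields A \<and> (\<forall>X\<in>vector_fields A. g W X = vderiv X f)"
  then have "g (W - Z) (W - Z) = 0"
    using Z by (simp add: metric_simps vector_field_intros)
  then show "W = Z"
    using metric_zeroD[of "W - Z"] W Z by (simp add: vector_field_intros)
qed (use Z in blast)

end

section \<open>Almost coKaehler manifolds\<close>

locale almost_cokaehler_manifold = riemannian_manifold A g
  for A :: "('m::{t2_space,second_countable_topology}, 'e::euclidean_space) atlas" and g +
  fixes n :: nat and \<phi> :: "'m endo" and \<xi> :: "'m vfield" and \<eta> :: "'m form1"
  assumes cokaehler: "almost_cokaehler n A \<phi> \<xi> \<eta> g"
begin

section \<open>Algebra of the almost contact metric structure\<close>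

lemma contact: "almost_contact_metric n A \<phi> \<xi> \<eta> g"
  using cokaehler unfolding almost_cokaehler_def by blast

lemma xi_field: "\<xi> \<in> vector_fields A"
  and eta_form: "one_form A \<eta>"
  and phi_phi: "X \<in> vector_fields A \<Longrightarrow> \<phi> (\<phi> X) = - X + \<eta> X \<odot> \<xi>"
  and eta_xi: "\<eta> \<xi> = 1"
  and metric_phi_phi: "X \<in> vector_fields A \<Longrightarrow> Y \<in> vector_fields A \<Longrightarrow> g (\<phi> X) (\<phi> Y) = g X Y - \<eta> X * \<eta> Y"
  using contact unfolding almost_contact_metric_def by blast+

lemma phi_tensor: "tensor11 A \<phi>"
  using contact unfolding almost_contact_metric_def by blast

lemma phi_field: "X \<in> vector_fields A \<Longrightarrow> \<phi> X \<in> vector_fields A"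
  and phi_add: "X \<in> vector_fields A \<Longrightarrow> Y \<in> vector_fields A \<Longrightarrow> \<phi> (X + Y) = \<phi> X + \<phi> Y"
  and phi_fscale: "f \<in> smooth_funs A \<Longrightarrow> X \<in> vector_fields A \<Longrightarrow> \<phi> (f \<odot> X) = f \<odot> \<phi> X"
  using phi_tensor unfolding tensor11_def by blast+

lemma phi_uminus: "X \<in> vector_fields A \<Longrightarrow> \<phi> (- X) = - \<phi> X"
  using phi_fscale[OF smooth_uminus[OF smooth_one], of X] by simp

lemma phi_zero: "\<phi> 0 = 0"
  using phi_fscale[OF smooth_zero vector_field_zero] by simp

lemma phi_diff: "X \<in> vector_fields A \<Longrightarrow> Y \<in> vector_fields A \<Longrightarrow> \<phi> (X - Y) = \<phi> X - \<phi> Y"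
  using phi_add[of X "- Y"] by (simp add: phi_uminus vector_field_uminus)

lemmas eta_simps = one_form_simps[OF eta_form]

text \<open>The formula for the square of \<open>\<phi>\<close> kills \<open>\<xi>\<close>; used
  again on \<open>\<phi> \<xi>\<close> it makes that field a multiple c of \<open>\<xi>\<close>.
  Then c^2 is zero, hence c is.\<close>

lemma phi_xi: "\<phi> \<xi> = 0"
proof -
  define c where "c = \<eta> (\<phi> \<xi>)"
  have c: "c \<in> smooth_funs A" unfolding c_def by (intro one_form_smooth[OF eta_form] phi_field xi_field)
  have 0: "\<phi> (\<phi> \<xi>) = 0" using phi_phi[OF xi_field] eta_xi by simp
  then have 1: "\<phi> \<xi> = c \<odot> \<xi>"
    using phi_phi[OF phi_field[OF xi_field]] phi_zero by (simp add: c_def)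
  have "0 = \<phi> (c \<odot> \<xi>)" by (simp only: 0 1[symmetric])
  also have "\<dots> = c \<odot> \<phi> \<xi>" by (rule phi_fscale[OF c xi_field])
  also have "\<dots> = (c * c) \<odot> \<xi>" by (simp add: 1)
  finally have "\<eta> ((c * c) \<odot> \<xi>) = 0" by (simp add: eta_simps flip: \<open>0 = _\<close>)
  then have "c * c = 0" by (simp add: eta_simps c smooth_mult xi_field eta_xi)
  then have "c = 0" by (simp add: fun_eq_iff)
  then show ?thesis using 1 by simp
qed

text \<open>The third power of \<open>\<phi>\<close> is computed in two ways, from the inner and
  from the outer square; the results differ by
  \<open>\<eta> (\<phi> X) \<odot> \<xi>\<close>.\<close>

lemma eta_phi: assumes X: "X \<in> vector_fields A" shows "\<eta> (\<phi> X) = 0"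
proof -
  have s: "\<eta> (\<phi> X) \<in> smooth_funs A" "\<eta> X \<in> smooth_funs A"
    by (intro one_form_smooth[OF eta_form] phi_field X)+
  have "\<phi> (\<phi> (\<phi> X)) = - \<phi> X + \<eta> (\<phi> X) \<odot> \<xi>" by (rule phi_phi[OF phi_field[OF X]])
  moreover have "\<phi> (\<phi> (\<phi> X)) = - \<phi> X"
    using X s by (simp add: phi_phi[OF X] phi_diff phi_add phi_uminus phi_fscale phi_xi vector_field_intros xi_field)
  ultimately have "\<eta> (\<phi> X) \<odot> \<xi> = 0" by simp
  then have "\<eta> (\<eta> (\<phi> X) \<odot> \<xi>) = 0" by (simp add: eta_simps)
  then show ?thesis by (simp add: eta_simps s xi_field eta_xi)
qed

lemma metric_xi: "X \<in> vector_fields A \<Longrightarrow> g X \<xi> = \<eta> X"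
  using metric_phi_phi[OF _ xi_field, of X] by (simp add: phi_xi eta_xi metric_simps phi_field)

text \<open>Compatibility of the metric with \<open>\<phi>\<close>, applied to \<open>X\<close> and
  \<open>\<phi> Y\<close>; the terms in \<open>\<eta>\<close> vanish by
  \<open>eta_phi\<close>.\<close>

lemma phi_skew:
  assumes X: "X \<in> vector_fields A" and Y: "Y \<in> vector_fields A"
  shows "g (\<phi> X) Y = - g X (\<phi> Y)"
proof -
  have "g (\<phi> X) (\<phi> (\<phi> Y)) = g X (\<phi> Y)"
    using metric_phi_phi[OF X phi_field[OF Y]] by (simp add: eta_phi Y)
  then have "- g (\<phi> X) Y = g X (\<phi> Y)"
    using X Y by (simp add: phi_phi[OF Y] metric_simps phi_field xi_field vector_field_intros
        eta_simps metric_xi eta_phi)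
  then show ?thesis by (metis minus_minus)
qed

section \<open>The tensor h and the Lie derivative of the metric along \<xi>\<close>

abbreviation (input) two_h :: "'m endo" where "two_h \<equiv> lie11 \<xi> \<phi>"

lemma two_h_field: "X \<in> vector_fields A \<Longrightarrow> two_h X \<in> vector_fields A"
  by (simp add: lie11_def vector_field_intros phi_field xi_field)

text \<open>The form \<open>\<eta>\<close> is invariant under \<xi>, because it is closed and
  \<open>\<eta> \<xi>\<close> is constant.\<close>

lemma eta_lie:
  assumes X: "X \<in> vector_fields A" shows "\<eta> (bracket \<xi> X) = vderiv \<xi> (\<eta> X)"
proof -
  have "ext_d1 \<eta> \<xi> X = 0" using cokaehler X xi_field unfolding almost_cokaehler_def by blast
  then show ?thesis using X by (simp add: ext_d1_def eta_xi vderiv_one)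
qed

text \<open>Lie derivative along \<xi> of the formula for the square of \<open>\<phi>\<close>: its
  right-hand side is invariant, since \<open>\<eta>\<close> and \<xi> are.\<close>

lemma two_h_phi:
  assumes X: "X \<in> vector_fields A" shows "two_h (\<phi> X) = - \<phi> (two_h X)"
proof -
  note rules = X xi_field eta_simps vector_field_intros phi_field smooth_vderiv smooth_intros
  have "two_h (\<phi> X) + \<phi> (two_h X) = bracket \<xi> (\<phi> (\<phi> X)) - \<phi> (\<phi> (bracket \<xi> X))"
    by (simp add: lie11_def phi_diff rules)
  also have "\<dots> = 0"
    by (simp add: phi_phi rules eta_lie bracket_add_right bracket_fscale_right bracket_diff_right
        bracket_self)
  finally show ?thesis by (simp add: eq_neg_iff_add_eq_0)
qed

text \<open>This is the form \<open>b\<close> of the introductory sketch.\<close>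

abbreviation (input) lie_g :: "'m form2" where "lie_g \<equiv> lie02 \<xi> g"

lemmas lie_g_tensor = tensor02_lie02[OF metric_tensor xi_field]
lemmas lie_g_simps = one_form_simps[OF tensor02_left[OF lie_g_tensor]] one_form_simps[OF tensor02_right[OF lie_g_tensor]]

lemma lie_g_sym: "X \<in> vector_fields A \<Longrightarrow> Y \<in> vector_fields A \<Longrightarrow> lie_g X Y = lie_g Y X"
  by (simp add: lie02_def metric_sym[of X Y] metric_sym[of X "bracket \<xi> Y"]
      metric_sym[of "bracket \<xi> X" Y] vector_field_bracket xi_field)

lemma lie_g_xi: "X \<in> vector_fields A \<Longrightarrow> lie_g X \<xi> = 0"
  by (simp add: lie02_def metric_xi eta_lie vector_field_bracket xi_field bracket_self metric_simps)

text \<open>As \<open>\<phi> \<xi>\<close> is 0, closedness of the fundamental form, evaluated with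
  \<xi> in one slot, says that its Lie derivative along \<xi> vanishes. The product rule splits this
  into a derivative of \<open>g\<close> and a derivative of \<open>\<phi>\<close>.\<close>

lemma lie_g_phi:
  assumes X: "X \<in> vector_fields A" and Y: "Y \<in> vector_fields A"
  shows "lie_g X (\<phi> Y) = - g X (two_h Y)"
proof -
  note rules = X Y xi_field vector_field_intros phi_field metric_simps
  have "ext_d2 (fundamental_form g \<phi>) \<xi> X Y = 0"
    using cokaehler X Y xi_field unfolding almost_cokaehler_def by blast
  moreover have "g \<xi> (\<phi> X) = 0"
    using metric_sym[OF xi_field phi_field[OF X]] metric_xi[OF phi_field[OF X]] eta_phi[OF X] by simp
  moreover have "g (bracket Y \<xi>) (\<phi> X) = g X (\<phi> (bracket \<xi> Y))"
    using phi_skew[of "bracket \<xi> Y" X] metric_sym[OF X, of "\<phi> (bracket \<xi> Y)"]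
    by (simp add: bracket_swap[of Y \<xi>] rules)
  ultimately have "vderiv \<xi> (g X (\<phi> Y)) = g (bracket \<xi> X) (\<phi> Y) + g X (\<phi> (bracket \<xi> Y))"
    by (simp add: ext_d2_def fundamental_form_def phi_xi rules vderiv_zero algebra_simps)
  then show ?thesis
    by (simp add: lie02_def lie11_def rules algebra_simps)
qed

text \<open>Put \<open>\<phi> Y\<close> for \<open>Y\<close> in \<open>lie_g_phi\<close>; the
  multiple of \<xi> in \<open>\<phi> (\<phi> Y)\<close> is killed by
  \<open>lie_g_xi\<close>.\<close>

lemma lie_g_eq:
  assumes X: "X \<in> vector_fields A" and Y: "Y \<in> vector_fields A"
  shows "lie_g X Y = g (\<phi> X) (two_h Y)"
proof -
  have "- lie_g X Y = lie_g X (\<phi> (\<phi> Y))"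
    by (simp add: phi_phi X Y lie_g_simps lie_g_xi xi_field vector_field_intros eta_simps)
  also have "\<dots> = g X (\<phi> (two_h Y))"
    by (simp add: lie_g_phi X Y phi_field two_h_phi metric_simps two_h_field)
  also have "\<dots> = - g (\<phi> X) (two_h Y)" by (simp add: phi_skew X Y two_h_field)
  finally show ?thesis by simp
qed

text \<open>Both sides equal \<open>- g (\<phi> X) (two_h Y)\<close>. This sign is what later
  removes all terms in \<open>lie_g\<close> from the sum of two mixed Killing equations.\<close>

lemma lie_g_phi_phi:
  assumes X: "X \<in> vector_fields A" and Y: "Y \<in> vector_fields A"
  shows "lie_g (\<phi> X) (\<phi> Y) = - lie_g X Y"
  by (simp add: lie_g_phi X Y phi_field) (simp add: lie_g_eq X Y)

text \<open>Differentiating \<open>lie_g(\<phi>X, \<phi>X) = -lie_g(X, X)\<close> along \<open>\<xi>\<close> leaves only the square of \<open>two_h\<close>.\<close>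

lemma lie_lie_g_phi_phi:
  assumes X: "X \<in> vector_fields A"
  shows "lie02 \<xi> lie_g X X + lie02 \<xi> lie_g (\<phi> X) (\<phi> X) = g (two_h X) (two_h X) + g (two_h X) (two_h X)"
proof -
  note rules = X xi_field vector_field_intros phi_field two_h_field
  \<comment> \<open>The part \<open>\<phi> (bracket \<xi> X)\<close> is absorbed by
    \<open>lie_g_phi_phi\<close>; the part \<open>two_h X\<close> enters through both slots and
    gives the two squares, in total 8 |hX|^2.\<close>
  have L: "bracket \<xi> (\<phi> X) = two_h X + \<phi> (bracket \<xi> X)" by (simp add: lie11_def)
  have 1: "lie_g (two_h X) (\<phi> X) = - g (two_h X) (two_h X)" by (rule lie_g_phi) (simp_all add: rules)
  have 2: "lie_g (\<phi> X) (two_h X) = - g (two_h X) (two_h X)" using lie_g_sym[of "two_h X" "\<phi> X"] 1 by (simp add: rules)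
  have "lie02 \<xi> lie_g (\<phi> X) (\<phi> X) = vderiv \<xi> (lie_g (\<phi> X) (\<phi> X))
      - lie_g (two_h X + \<phi> (bracket \<xi> X)) (\<phi> X) - lie_g (\<phi> X) (two_h X + \<phi> (bracket \<xi> X))"
    unfolding lie02_def[of \<xi> lie_g] L ..
  also have "\<dots> = - vderiv \<xi> (lie_g X X) + g (two_h X) (two_h X) + lie_g (bracket \<xi> X) X
      + g (two_h X) (two_h X) + lie_g X (bracket \<xi> X)"
    by (simp add: rules lie_g_simps lie_g_phi_phi vderiv_uminus 1 2)
  finally show ?thesis unfolding lie02_def[of \<xi> lie_g] by simp
qed

lemma xi_metric: "X \<in> vector_fields A \<Longrightarrow> g \<xi> X = \<eta> X"
  using metric_sym[OF xi_field] metric_xi by simp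

lemma lie_g_xi_left: "X \<in> vector_fields A \<Longrightarrow> lie_g \<xi> X = 0"
  using lie_g_sym[OF xi_field] lie_g_xi by simp

section \<open>Mixed Killing fields of the form \<alpha>\<xi>\<close>

context
  fixes \<alpha> :: "'m \<Rightarrow> real"
  assumes \<alpha>: "\<alpha> \<in> smooth_funs A"
begin

lemma bracket_scaled_xi:
  "X \<in> vector_fields A \<Longrightarrow> bracket (\<alpha> \<odot> \<xi>) X = \<alpha> \<odot> bracket \<xi> X - vderiv X \<alpha> \<odot> \<xi>"
  by (rule bracket_fscale_left[OF xi_field _ \<alpha>])

text \<open>Each bracket with \<open>\<alpha> \<odot> \<xi>\<close> carries an extra multiple of
  \<xi>, and pairing \<xi> with the metric gives \<open>\<eta>\<close>.\<close>

lemma lie_metric_scaled_xi: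
  assumes X: "X \<in> vector_fields A" and Y: "Y \<in> vector_fields A"
  shows "lie02 (\<alpha> \<odot> \<xi>) g X Y = \<alpha> * lie_g X Y + vderiv X \<alpha> * \<eta> Y + vderiv Y \<alpha> * \<eta> X"
  unfolding lie02_def[of "\<alpha> \<odot> \<xi>"]
  by (simp add: bracket_scaled_xi X Y \<alpha> xi_field vector_field_intros smooth_vderiv metric_simps
      xi_metric metric_xi smooth_mult) (simp add: lie02_def algebra_simps)

text \<open>Although \<open>X\<close> is horizontal, its bracket with the field has
  \<open>\<eta>\<close>-component \<open>- vderiv X \<alpha>\<close>. Through the mixed terms of
  \<open>lie_metric_scaled_xi\<close> each slot then contributes one square of
  \<open>vderiv X \<alpha>\<close>.\<close>

lemma lie_lie_metric_scaled_xi: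
  assumes X: "X \<in> vector_fields A" and X0: "\<eta> X = 0"
  shows "lie02 (\<alpha> \<odot> \<xi>) (lie02 (\<alpha> \<odot> \<xi>) g) X X =
    \<alpha> * vderiv \<xi> \<alpha> * lie_g X X + \<alpha> * \<alpha> * lie02 \<xi> lie_g X X + (vderiv X \<alpha> * vderiv X \<alpha> + vderiv X \<alpha> * vderiv X \<alpha>)"
proof -
  let ?V = "\<alpha> \<odot> \<xi>" and ?T = "lie02 (\<alpha> \<odot> \<xi>) g"
  note rules = X X0 \<alpha> xi_field vector_field_intros smooth_vderiv smooth_mult
  have V: "bracket ?V X \<in> vector_fields A" by (simp add: rules)
  have bV: "lie_g (bracket ?V X) X = \<alpha> * lie_g (bracket \<xi> X) X" "lie_g X (bracket ?V X) = \<alpha> * lie_g X (bracket \<xi> X)"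
    by (simp_all add: bracket_scaled_xi rules lie_g_simps lie_g_xi lie_g_xi_left)
  have etaV: "\<eta> (bracket ?V X) = - vderiv X \<alpha>"
    by (simp add: bracket_scaled_xi rules eta_simps eta_lie eta_xi vderiv_zero)
  have T1: "?T X X = \<alpha> * lie_g X X" by (simp add: lie_metric_scaled_xi rules)
  have T2: "?T (bracket ?V X) X = \<alpha> * (\<alpha> * lie_g (bracket \<xi> X) X) - vderiv X \<alpha> * vderiv X \<alpha>"
    using lie_metric_scaled_xi[OF V X] by (simp add: bV etaV X0)
  have T3: "?T X (bracket ?V X) = \<alpha> * (\<alpha> * lie_g X (bracket \<xi> X)) - vderiv X \<alpha> * vderiv X \<alpha>"
    using lie_metric_scaled_xi[OF X V] by (simp add: bV etaV X0)
  have "lie02 ?V ?T X X = \<alpha> * (\<alpha> * vderiv \<xi> (lie_g X X) + lie_g X X * vderiv \<xi> \<alpha>) -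
      (\<alpha> * (\<alpha> * lie_g (bracket \<xi> X) X) - vderiv X \<alpha> * vderiv X \<alpha>) -
      (\<alpha> * (\<alpha> * lie_g X (bracket \<xi> X)) - vderiv X \<alpha> * vderiv X \<alpha>)"
    unfolding lie02_def[of ?V ?T] T1 T2 T3
    by (simp add: vderiv_mult rules lie_g_simps)
  then show ?thesis unfolding lie02_def[of \<xi> lie_g] by (simp add: algebra_simps)
qed

context
  fixes f :: "'m \<Rightarrow> real"
  assumes mixed: "mixed_killing A g (\<alpha> \<odot> \<xi>) f"
begin

text \<open>With \<open>X\<close> also \<open>\<phi> X\<close> is horizontal. Adding the two
  equations removes \<open>f\<close> and \<open>vderiv \<xi> \<alpha>\<close> together with
  \<open>lie_g\<close>, and a vanishing sum of three nonnegative terms remains.\<close>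

lemma mixed_killing_horizontal:
  assumes X: "X \<in> vector_fields A" and X0: "\<eta> X = 0"
  shows "\<alpha> \<odot> two_h X = 0" "vderiv X \<alpha> = 0"
proof -
  let ?Z = "\<alpha> \<odot> two_h X"
  note rules = X \<alpha> xi_field vector_field_intros phi_field two_h_field smooth_vderiv smooth_mult
  have Z: "?Z \<in> vector_fields A" by (simp add: rules)
  have eq: "\<alpha> * vderiv \<xi> \<alpha> * lie_g Y Y + \<alpha> * \<alpha> * lie02 \<xi> lie_g Y Y + (vderiv Y \<alpha> * vderiv Y \<alpha> + vderiv Y \<alpha> * vderiv Y \<alpha>)
      = f * (\<alpha> * lie_g Y Y)" if "Y \<in> vector_fields A" "\<eta> Y = 0" for Y
    using mixed that unfolding mixed_killing_def
    by (metis (no_types, lifting) lie_lie_metric_scaled_xi lie_metric_scaled_xi mult_zero_right add_0_right)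
  have sum: "g ?Z ?Z p + (vderiv X \<alpha> p)\<^sup>2 + (vderiv (\<phi> X) \<alpha> p)\<^sup>2 = 0" for p
  proof -
    have l: "lie02 \<xi> lie_g (\<phi> X) (\<phi> X) p = 2 * g (two_h X) (two_h X) p - lie02 \<xi> lie_g X X p"
      using fun_cong[OF lie_lie_g_phi_phi[OF X], of p] by simp
    have m: "lie_g (\<phi> X) (\<phi> X) p = - lie_g X X p" using lie_g_phi_phi[OF X X] by simp
    have "2 * (\<alpha> p * \<alpha> p * g (two_h X) (two_h X) p + (vderiv X \<alpha> p)\<^sup>2 + (vderiv (\<phi> X) \<alpha> p)\<^sup>2) = 0"
      using fun_cong[OF eq[OF X X0], of p] fun_cong[OF eq[OF phi_field[OF X] eta_phi[OF X]], of p]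
      by (simp add: l m power2_eq_square algebra_simps)
    moreover have "g ?Z ?Z p = \<alpha> p * \<alpha> p * g (two_h X) (two_h X) p"
      by (simp add: metric_simps rules)
    ultimately show ?thesis by simp
  qed
  have nn: "g ?Z ?Z p \<ge> 0" for p using metric_nonneg[OF Z] .
  have "g ?Z ?Z p = 0 \<and> vderiv X \<alpha> p = 0" for p
    using sum[of p] nn[of p] zero_le_power2[of "vderiv X \<alpha> p"] zero_le_power2[of "vderiv (\<phi> X) \<alpha> p"]
    by (smt (verit) power2_eq_iff zero_power2 power_eq_0_iff)
  then have "g ?Z ?Z = 0" "vderiv X \<alpha> = 0" by (auto simp: fun_eq_iff)
  then show "?Z = 0" "vderiv X \<alpha> = 0" using metric_zeroD[OF Z] by auto
qed

text \<open>\<open>\<phi> (\<phi> X)\<close> is horizontal for every \<open>X\<close>. Since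
  \<open>two_h\<close> anticommutes with \<open>\<phi>\<close> and has horizontal values, it sends
  this field to \<open>- two_h X\<close>.\<close>

lemma mixed_killing_two_h: assumes X: "X \<in> vector_fields A" shows "\<alpha> \<odot> two_h X = 0"
proof -
  have "\<eta> (two_h X) = 0"
    by (simp add: lie11_def X xi_field eta_simps vector_field_intros phi_field eta_lie eta_phi vderiv_zero)
  then have "two_h (\<phi> (\<phi> X)) = - two_h X"
    by (simp add: two_h_phi[OF phi_field[OF X]] two_h_phi[OF X] phi_field X two_h_field phi_uminus)
       (simp add: phi_phi X two_h_field)
  moreover have "\<alpha> \<odot> two_h (\<phi> (\<phi> X)) = 0"
    by (intro mixed_killing_horizontal phi_field X eta_phi)
  ultimately show ?thesis by simp
qed

text \<open>Again the horizontal case at \<open>\<phi> (\<phi> X)\<close>, which is \<open>X\<close>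
  up to sign and a multiple of \<xi>.\<close>

lemma mixed_killing_vderiv: assumes X: "X \<in> vector_fields A" shows "vderiv X \<alpha> = \<eta> X * vderiv \<xi> \<alpha>"
proof -
  have "vderiv (\<phi> (\<phi> X)) \<alpha> = 0"
    by (intro mixed_killing_horizontal phi_field X eta_phi)
  then show ?thesis by (simp add: phi_phi X)
qed

lemma mixed_killing_grad: "grad A g \<alpha> = vderiv \<xi> \<alpha> \<odot> \<xi>"
  by (rule grad_eqI)
     (simp_all add: vector_field_intros smooth_vderiv xi_field \<alpha> metric_simps xi_metric
       mixed_killing_vderiv[symmetric] mult.commute[of "vderiv \<xi> \<alpha>"])

end

end

end

section \<open>The two identities\<close>

theorem theorem9:
  fixes A :: "('m::{t2_space,second_countable_topology}, 'e::euclidean_space) atlas"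
    and \<phi> :: "'m endo" and \<xi> :: "'m vfield" and \<eta> :: "'m form1" and g :: "'m form2"
    and D :: "'m vfield \<Rightarrow> 'm vfield \<Rightarrow> 'm vfield"
    and \<alpha> f :: "'m \<Rightarrow> real" and n :: nat
  defines "h \<equiv> reeb_h \<phi> \<xi>"
  assumes "almost_cokaehler n A \<phi> \<xi> \<eta> g"
    and "levi_civita A g D"
    and "\<alpha> \<in> smooth_funs A"
    and "mixed_killing A g (\<alpha> \<odot> \<xi>) f"
  shows "(\<forall>X\<in>vector_fields A.
            \<alpha>^2 \<odot> cov11 D \<xi> h X =
              vderiv (\<phi> X) \<alpha> \<odot> (grad A g \<alpha> - vderiv \<xi> \<alpha> \<odot> \<xi>)
              + \<alpha>^2 \<odot> \<phi> (h (h X))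
              + (\<alpha> * (f + \<alpha> - vderiv \<xi> \<alpha>)) \<odot> h X)
       \<and> (vderiv \<xi> \<alpha>)^2 = g (grad A g \<alpha>) (grad A g \<alpha>) + \<alpha>^2 * trace11 A (\<lambda>X. h (h X))"
proof -
  have ac: "almost_contact_metric n A \<phi> \<xi> \<eta> g"
    using assms(2) unfolding almost_cokaehler_def by blast
  interpret almost_cokaehler_manifold A g n \<phi> \<xi> \<eta>
    by unfold_locales (use ac assms(2) in \<open>auto simp: almost_contact_metric_def\<close>)
  note \<alpha> = assms(4) and mixed = assms(5)
  have h_field: "h X \<in> vector_fields A" if "X \<in> vector_fields A" for X
    unfolding h_def reeb_h_def by (intro vector_field_scaleR two_h_field that)
  have h0: "\<alpha> \<odot> h X = 0" if X: "X \<in> vector_fields A" for X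
  proof -
    have "\<alpha> \<odot> h X = (1/2) *\<^sub>R (\<alpha> \<odot> lie11 \<xi> \<phi> X)"
      by (simp add: h_def reeb_h_def fscale_def fun_eq_iff)
    then show ?thesis by (simp add: mixed_killing_two_h[OF \<alpha> mixed X])
  qed
  have h0': "(\<alpha> * c) \<odot> h X = 0" if "X \<in> vector_fields A" for X c
    using fscale_simps(4)[of c \<alpha> "h X"] by (simp add: h0[OF that] mult.commute)
  note gr = mixed_killing_grad[OF \<alpha> mixed]
  have conn: "affine_connection A D" using assms(3) unfolding levi_civita_def by blast
  have D_field: "D \<xi> X \<in> vector_fields A" if "X \<in> vector_fields A" for X
    using conn that xi_field unfolding affine_connection_def tensor11_def by blast
  have D_scale: "D \<xi> (u \<odot> X) = vderiv \<xi> u \<odot> X + u \<odot> D \<xi> X"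
    if "u \<in> smooth_funs A" "X \<in> vector_fields A" for u X
    using conn that xi_field unfolding affine_connection_def by blast
  have D_zero: "D \<xi> 0 = 0"
    using D_scale[OF smooth_zero vector_field_zero] by (simp add: vderiv_zero xi_field)
  have "\<alpha>^2 \<odot> cov11 D \<xi> h X =
      vderiv (\<phi> X) \<alpha> \<odot> (grad A g \<alpha> - vderiv \<xi> \<alpha> \<odot> \<xi>) + \<alpha>^2 \<odot> \<phi> (h (h X))
      + (\<alpha> * (f + \<alpha> - vderiv \<xi> \<alpha>)) \<odot> h X" if X: "X \<in> vector_fields A" for X
  proof -
    \<comment> \<open>Covariant derivative along \<xi> of the identity
      \<open>\<alpha> \<odot> h X = 0\<close>. Multiplying by \<open>\<alpha>\<close> once more
      removes the first term and leaves \<open>\<alpha>^2 \<odot> D \<xi> (h X) = 0\<close>.\<close>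
    have "vderiv \<xi> \<alpha> \<odot> h X + \<alpha> \<odot> D \<xi> (h X) = 0"
      using D_scale[OF \<alpha> h_field[OF X]] by (simp add: h0[OF X] D_zero)
    then have "\<alpha> \<odot> (vderiv \<xi> \<alpha> \<odot> h X + \<alpha> \<odot> D \<xi> (h X)) = 0" by simp
    then have "\<alpha>^2 \<odot> D \<xi> (h X) = 0"
      by (simp add: fscale_add h0'[OF X] power2_eq_square)
    moreover have "\<alpha>^2 \<odot> h (D \<xi> X) = 0" "\<alpha>^2 \<odot> h (h X) = 0"
      by (simp_all add: power2_eq_square h0' D_field h_field X)
    moreover have "\<alpha>^2 \<odot> \<phi> (h (h X)) = \<phi> (\<alpha>^2 \<odot> h (h X))"
      by (simp add: phi_fscale power2_eq_square smooth_mult \<alpha> h_field X)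
    ultimately show ?thesis
      by (simp add: cov11_def fscale_diff gr h0'[OF X] phi_zero)
  qed
  moreover have "(vderiv \<xi> \<alpha>)^2 = g (grad A g \<alpha>) (grad A g \<alpha>) + \<alpha>^2 * trace11 A (\<lambda>X. h (h X))"
  proof -
    have "g (grad A g \<alpha>) (grad A g \<alpha>) = (vderiv \<xi> \<alpha>)^2"
      by (simp add: gr metric_simps smooth_vderiv xi_field \<alpha> vector_field_intros metric_xi eta_xi eta_simps
          power2_eq_square)
    \<comment> \<open>The product is checked pointwise: where \<open>\<alpha>\<close> is nonzero,
      \<open>\<alpha> \<odot> h (h X) = 0\<close> forces the endomorphism, and so its trace, to
      vanish.\<close>
    moreover have "\<alpha> p = 0 \<or> trace11 A (\<lambda>X. h (h X)) p = 0" for p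
    proof (cases "\<alpha> p = 0")
      case False
      have "h (h X) p = 0" if "X \<in> vector_fields A" for X
        using fun_cong[OF h0[OF h_field[OF that]], of p] False by (simp add: fscale_def)
      then show ?thesis using trace11_eq_0[of "\<lambda>X. h (h X)" p] by blast
    qed simp
    then have "\<alpha>^2 * trace11 A (\<lambda>X. h (h X)) = 0"
      by (auto simp: fun_eq_iff power2_eq_square)
    ultimately show ?thesis by simp
  qed
  ultimately show ?thesis by blast
qed

end
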